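(* Let $n,m$ be integers with $m\ge n+2\ge 3$, let $[k]=\{1,\dots,k\}$, let $\Delta^n$ be the $n$-simplex on the vertex set $[n+1]$, and let $\mathcal{K}$ be a simplicial complex on $[m]$. Suppose the following conditions hold: (1) $[n+1]\notin\mathcal{K}$. (2) For every $J=\{1,\dots,n+1,j\}$ with $n+2\le j\le m$ and every $1\le i\le n+1$, one has $J\setminus\{i\}\in\mathcal{K}$. (3) For every $J=\{1,\dots,n+1,j,k\}$ with $n+2\le j<k\le m$, one has $\operatorname{rank}\widetilde{H}^n(\mathcal{K}_J)\le 1$. (4) For every $J=\{1,\dots,n+1,j,k\}$ with $n+2\le j<k\le m$, either $J\setminus\{i\}\in\mathcal{K}$ for all $1\le i\le n+1$, or $J\setminus\{i\}\notin\mathcal{K}$ for all $1\le i\le n+1$. Let $\lambda_{[n+1]}\mathcal{K}=\mathcal{K}\cup_{\partial\Delta^n}\Delta^n=\mathcal{K}\cup\{[n+1]\}$ be the simplicial complex obtained from $\mathcal{K}$ by adding the simplex $[n+1]$. Then: (1) $\operatorname{rank} HH^*(\mathcal{Z}_{\lambda_{[n+1]}\mathcal{K}})=\operatorname{rank} HH^*(\mathcal{Z}_{\mathcal{K}})-2$, if there exists some $J=\{1,\dots,n+1,j,k\}$ with $n+2\le j<k\le m$ such that $\operatorname{rank}\widetilde{H}^n(\mathcal{K}_J)=1$. (2) $\operatorname{rank} HH^*(\mathcal{Z}_{\lambda_{[n+1]}\mathcal{K}})=\operatorname{rank} HH^*(\mathcal{Z}_{\mathcal{K}})$, otherwise.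
   Context: All cohomology is taken with coefficients in $\mathbb{R}$, and rank means dimension over $\mathbb{R}$. A simplicial complex $\mathcal{K}$ on $[m]=\{1,\dots,m\}$ is assumed to satisfy $\varnothing\in\mathcal{K}$ and $\{i\}\in\mathcal{K}$ for all $i\in[m]$. For $I\subset[m]$, $\mathcal{K}_I=\{\sigma\in\mathcal{K}:\sigma\subset I\}$ is the full subcomplex, and $\widetilde{H}^*(\mathcal{K}_I)$ is its reduced simplicial cohomology, with the convention $\widetilde{H}^*(\mathcal{K}_\varnothing)=\widetilde{H}^{-1}(\mathcal{K}_\varnothing)=\mathbb{R}$. The moment-angle complex is $\mathcal{Z}_{\mathcal{K}}=\bigcup_{I\in\mathcal{K}}(D^2,S^1)^I\subset(D^2)^m$, where $(D^2,S^1)^I=\{(z_1,\dots,z_m)\in(D^2)^m: |z_j|=1\text{ if }j\notin I\}$. Its cohomology is $H^*(\mathcal{Z}_{\mathcal{K}})\cong\bigoplus_{I\subset[m]}\widetilde{H}^*(\mathcal{K}_I)$. Double cohomology: for $i\in I\subset[m]$ let $\psi_{p;i,I}:\widetilde{H}^p(\mathcal{K}_I)\to\widetilde{H}^p(\mathcal{K}_{I\setminus\{i\}})$ be induced by inclusion, and set $d'_p=(-1)^{p+1}\sum_{i\in I}\varepsilon(i,I)\,\psi_{p;i,I}:\widetilde{H}^p(\mathcal{K}_I)\to\bigoplus_{i\in I}\widetilde{H}^p(\mathcal{K}_{I\setminus\{i\}})$, where $\varepsilon(i,I)=(-1)^{\#\{l\in I:\,l<i\}}$. This defines $d'$ on $\bigoplus_{I\subset[m]}\widetilde{H}^*(\mathcal{K}_I)\cong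 H^*(\mathcal{Z}_{\mathcal{K}})$ with $(d')^2=0$. The double cohomology is $HH^*(\mathcal{Z}_{\mathcal{K}})=H(H^*(\mathcal{Z}_{\mathcal{K}}),d')=\ker d'/\operatorname{Im}d'$, and $\operatorname{rank}HH^*(\mathcal{Z}_{\mathcal{K}})$ is its total rank. *)

theory Defs
  imports "Jordan_Normal_Form.VS_Connect" "HOL-Algebra.AbelCoset"
begin

text \<open>Real vector spaces are module records over \<^term>\<open>class_ring :: real ring\<close>.\<close>

abbreviation rank :: "(real, 'v, 'x) module_scheme \<Rightarrow> nat" where
  "rank V \<equiv> vectorspace.dim (class_ring :: real ring) V"

text \<open>
  The quotient of a module by a submodule \<open>N\<close>, with the cosets of \<open>N\<close> as elements.  Only addition,
  zero and scalar multiplication are meaningful; \<open>mult\<close> and \<open>one\<close> are unused fields of the record.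
\<close>
definition quotient_module :: "('a, 'b, 'c) module_scheme \<Rightarrow> 'b set \<Rightarrow> ('a, 'b set) module" where
  "quotient_module M N =
    \<lparr>carrier = a_rcosets\<^bsub>M\<^esub> N,
     mult = (\<lambda>A B. N),
     one = N,
     zero = N,
     add = set_add M,
     smult = (\<lambda>r A. \<Union>a\<in>A. N +>\<^bsub>M\<^esub> (r \<odot>\<^bsub>M\<^esub> a))\<rparr>"

text \<open>External direct sum of a family of modules (again with unused \<open>mult\<close> and \<open>one\<close>).\<close>
definition module_dsum :: "'i set \<Rightarrow> ('i \<Rightarrow> ('a, 'b, 'c) module_scheme) \<Rightarrow> ('a, 'i \<Rightarrow> 'b) module" where
  "module_dsum A M =
    \<lparr>carrier = {x \<in> (\<Pi>\<^sub>E i\<in>A. carrier (M i)). finite {i \<in> A. x i \<noteq> \<zero>\<^bsub>M i\<^esub>}},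
     mult = (\<lambda>x y. \<lambda>i\<in>A. \<zero>\<^bsub>M i\<^esub>),
     one = (\<lambda>i\<in>A. \<zero>\<^bsub>M i\<^esub>),
     zero = (\<lambda>i\<in>A. \<zero>\<^bsub>M i\<^esub>),
     add = (\<lambda>x y. \<lambda>i\<in>A. x i \<oplus>\<^bsub>M i\<^esub> y i),
     smult = (\<lambda>r x. \<lambda>i\<in>A. r \<odot>\<^bsub>M i\<^esub> x i)\<rparr>"

definition simplicial_complex :: "nat \<Rightarrow> nat set set \<Rightarrow> bool" where
  "simplicial_complex m K \<longleftrightarrow>
     K \<subseteq> Pow {1..m} \<and> {} \<in> K \<and> (\<forall>i\<in>{1..m}. {i} \<in> K) \<and> (\<forall>\<sigma>\<in>K. \<forall>\<tau>\<subseteq>\<sigma>. \<tau> \<in> K)"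

definition full_subcomplex :: "nat set set \<Rightarrow> nat set \<Rightarrow> nat set set" where
  "full_subcomplex K I = {\<sigma>\<in>K. \<sigma> \<subseteq> I}"

text \<open>The empty simplex is the unique simplex of dimension \<open>-1\<close>; it makes the cohomology reduced.\<close>
definition simplices :: "nat set set \<Rightarrow> int \<Rightarrow> nat set set" where
  "simplices K p = {\<sigma>\<in>K. int (card \<sigma>) = p + 1}"

definition eps :: "nat \<Rightarrow> nat set \<Rightarrow> real" where
  "eps i I = (-1) ^ card {l\<in>I. l < i}"

abbreviation cochains :: "nat set set \<Rightarrow> int \<Rightarrow> (real, nat set \<Rightarrow> real) module" where
  "cochains K p \<equiv> ring.func_space (class_ring :: real ring) (simplices K p)"

text \<open>Simplices are oriented by the order of their vertices.\<close>
definition coboundary :: "nat set set \<Rightarrow> int \<Rightarrow> (nat set \<Rightarrow> real) \<Rightarrow> (nat set \<Rightarrow> real)" where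
  "coboundary K p f = (\<lambda>\<sigma>\<in>simplices K (p + 1). \<Sum>v\<in>\<sigma>. eps v \<sigma> * f (\<sigma> - {v}))"

definition cocycles :: "nat set set \<Rightarrow> int \<Rightarrow> (nat set \<Rightarrow> real) set" where
  "cocycles K p = a_kernel (cochains K p) (cochains K (p + 1)) (coboundary K p)"

definition coboundaries :: "nat set set \<Rightarrow> int \<Rightarrow> (nat set \<Rightarrow> real) set" where
  "coboundaries K p = coboundary K (p - 1) ` carrier (cochains K (p - 1))"

definition red_cohom :: "nat set set \<Rightarrow> int \<Rightarrow> (real, (nat set \<Rightarrow> real) set) module" where
  "red_cohom K p = quotient_module ((cochains K p)\<lparr>carrier := cocycles K p\<rparr>) (coboundaries K p)"

text \<open>
  The map in degree-\<open>p\<close> cohomology induced by the inclusion of a subcomplex \<open>L\<close>: restrict a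
  representing cocycle to the simplices of \<open>L\<close> and take its class.
\<close>
definition restr_cohom ::
  "nat set set \<Rightarrow> int \<Rightarrow> (nat set \<Rightarrow> real) set \<Rightarrow> (nat set \<Rightarrow> real) set" where
  "restr_cohom L p c =
     (\<Union>f\<in>c. coboundaries L p +>\<^bsub>cochains L p\<^esub> restrict f (simplices L p))"

definition psi ::
  "nat set set \<Rightarrow> int \<Rightarrow> nat \<Rightarrow> nat set \<Rightarrow> (nat set \<Rightarrow> real) set \<Rightarrow> (nat set \<Rightarrow> real) set" where
  "psi K p i I = restr_cohom (full_subcomplex K (I - {i})) p"

text \<open>
  Cohomology of the moment-angle complex in its Hochster decomposition: the direct sum of the reduced
  cohomology groups of all full subcomplexes on \<open>I \<subseteq> [m]\<close> in all degrees \<open>p\<close>.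
\<close>
definition H_Z :: "nat \<Rightarrow> nat set set \<Rightarrow> (real, nat set \<times> int \<Rightarrow> (nat set \<Rightarrow> real) set) module" where
  "H_Z m K = module_dsum (Pow {1..m} \<times> UNIV) (\<lambda>(I, p). red_cohom (full_subcomplex K I) p)"

text \<open>
  The \<open>J\<close>-component of \<open>d' x\<close> collects the contributions of the summands \<open>I\<close> with \<open>J = I - {i}\<close>
  for some \<open>i \<in> I\<close>, that is, of \<open>I = J \<union> {i}\<close> for \<open>i \<in> [m] - J\<close>.
\<close>
definition d' ::
  "nat \<Rightarrow> nat set set \<Rightarrow> (nat set \<times> int \<Rightarrow> (nat set \<Rightarrow> real) set)
     \<Rightarrow> (nat set \<times> int \<Rightarrow> (nat set \<Rightarrow> real) set)" where
  "d' m K x =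
     (\<lambda>(J, p)\<in>Pow {1..m} \<times> UNIV.
        \<Oplus>\<^bsub>red_cohom (full_subcomplex K J) p\<^esub> i\<in>{1..m} - J.
          ((-1) powi (p + 1) * eps i (insert i J))
            \<odot>\<^bsub>red_cohom (full_subcomplex K J) p\<^esub> psi K p i (insert i J) (x (insert i J, p)))"

definition HH :: "nat \<Rightarrow> nat set set
    \<Rightarrow> (real, (nat set \<times> int \<Rightarrow> (nat set \<Rightarrow> real) set) set) module" where
  "HH m K = quotient_module ((H_Z m K)\<lparr>carrier := a_kernel (H_Z m K) (H_Z m K) (d' m K)\<rparr>)
                            (d' m K ` carrier (H_Z m K))"

end

theory Submission
  imports Defs
begin

text \<open>
  Write \<open>\<sigma> = [n+1]\<close> and \<open>K' = K \<union> {\<sigma>}\<close>.  All the reduced groups \<open>H\<^sup>p(K\<^sub>I)\<close> together are the vertical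
  cohomology of one finite double complex, that of the real functions on the pairs \<open>(I, \<tau>)\<close> with
  \<open>\<tau> \<in> K\<close> and \<open>\<tau> \<subseteq> I \<subseteq> [m]\<close>, where the vertical differential is the simplicial coboundary in \<open>\<tau>\<close>
  and the horizontal one is the signed sum of the restrictions from \<open>I\<close> to \<open>I - {i}\<close>.  Let \<open>C\<close> be
  this space, \<open>Z\<close> and \<open>B\<close> the vertical cycles and boundaries and \<open>Q = horiz(Z) + B\<close>.  Then
  the sum of all \<open>H\<^sup>p(K\<^sub>I)\<close> is \<open>Z / B\<close> and the image of \<open>d'\<close> is \<open>Q / B\<close>, so that, as \<open>dim Z + dim B = dim C\<close>,
  rank-nullity turns the double cohomology into a count without quotients (\<open>rank_HH\<close>):
  \<open>rank HH = dim C - 2 dim Q\<close>.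

  The double complex of \<open>K'\<close> has the additional cells \<open>(I, \<sigma>)\<close> with \<open>\<sigma> \<subseteq> I\<close>.  Let \<open>A\<close> be the space
  of functions supported on them.  Forgetting these cells is a map onto \<open>C\<close> with kernel \<open>A\<close>
  that respects both differentials, and it maps \<open>Q'\<close> onto \<open>Q\<close> (\<open>restr_mixed_boundaries\<close>).  The
  reason is that for \<open>I \<noteq> \<sigma>\<close> the boundary of \<open>\<sigma>\<close> already bounds a cone in \<open>K\<^sub>I\<close>, so that a cocycle
  of \<open>K\<^sub>I\<close> remains one in \<open>K'\<^sub>I\<close>, and that over \<open>I = \<sigma>\<close> all restrictions land in the cohomology of
  a simplex.  Moreover \<open>A\<close> is horizontally acyclic, because some vertex lies outside \<open>\<sigma>\<close>, so
  \<open>dim A = 2 dim horiz(A)\<close>.  It remains to compare \<open>Q' \<inter> A\<close> with its subspace \<open>horiz(A)\<close>.  For \<open>x\<close>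
  in \<open>Q' \<inter> A\<close> the function \<open>horiz x\<close> is a vertical boundary in \<open>A\<close>, and by the cone argument it can
  only be nonzero at \<open>(\<sigma>, \<sigma>)\<close>.  Its value there, \<open>\<theta> x\<close>, is therefore the only obstruction to
  \<open>x \<in> horiz(A)\<close>, and counting dimensions gives (\<open>rank_HH_attachment\<close>): attaching \<open>\<sigma>\<close> lowers
  \<open>rank HH\<close> by 2 if \<open>\<theta>\<close> is nonzero on \<open>Q' \<inter> A\<close> and leaves it unchanged otherwise.

  Finally \<open>\<theta> (horiz z + vert g)\<close> is a sum over the pairs \<open>{j, k}\<close> outside \<open>\<sigma>\<close>, in which the
  summand of \<open>{j, k}\<close> evaluates \<open>z\<close> on the suspension of \<open>\<partial>\<sigma>\<close> with apices \<open>j\<close> and \<open>k\<close>.  Let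
  \<open>J = \<sigma> \<union> {j, k}\<close>.  If all the sets \<open>J - {i}\<close> with \<open>i \<in> \<sigma>\<close> are simplices, then they fill this
  suspension and the summand vanishes (\<open>theta_zero\<close>); in this case \<open>K\<^sub>J\<close> is a cone and
  \<open>H\<^sup>n(K\<^sub>J) = 0\<close> (\<open>linked_acyclic\<close>).  If none of them is a simplex, the suspension is an
  \<open>n\<close>-cycle of the \<open>n\<close>-dimensional complex \<open>K\<^sub>J\<close>, so \<open>H\<^sup>n(K\<^sub>J) \<noteq> 0\<close> (\<open>unlinked_nontrivial\<close>).  The
  hypothesis that the rank is at most 1 then forces some \<open>J - {i, l}\<close> to be missing, since
  otherwise any two of the boundaries of the \<open>J - {i}\<close> would be independent \<open>n\<close>-cycles
  (\<open>unlinked_rank_two\<close>), and with this missing face a suitable indicator function can be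
  completed to an \<open>x\<close> with \<open>\<theta> x \<noteq> 0\<close> (\<open>theta_nonzero\<close>).
\<close>

section \<open>Finite-dimensional real spaces, quotients and homology\<close>

abbreviation vsub :: "(real, 'v, 'x) module_scheme \<Rightarrow> 'v set \<Rightarrow> (real, 'v, 'x) module_scheme" where
  "vsub V S \<equiv> V\<lparr>carrier := S\<rparr>"

definition fin_dim_space :: "(real, 'v, 'x) module_scheme \<Rightarrow> bool" where
  "fin_dim_space V \<longleftrightarrow> vectorspace class_ring V \<and> vectorspace.fin_dim class_ring V"

text \<open>
  The target is often only recognised as a vector space by means of such an \<open>f\<close>, so the condition at
  zero does not follow from the others.
\<close>
definition linear_on :: "(real, 'v, 'x) module_scheme \<Rightarrow> (real, 'w, 'y) module_scheme \<Rightarrow> ('v \<Rightarrow> 'w) \<Rightarrow> bool" where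
  "linear_on V W f \<longleftrightarrow>
     (\<forall>x\<in>carrier V. \<forall>y\<in>carrier V. f (x \<oplus>\<^bsub>V\<^esub> y) = f x \<oplus>\<^bsub>W\<^esub> f y) \<and>
     (\<forall>r. \<forall>x\<in>carrier V. f (r \<odot>\<^bsub>V\<^esub> x) = r \<odot>\<^bsub>W\<^esub> f x) \<and> f \<zero>\<^bsub>V\<^esub> = \<zero>\<^bsub>W\<^esub>"

definition lin_subspace :: "'v set \<Rightarrow> (real, 'v, 'x) module_scheme \<Rightarrow> bool" where
  "lin_subspace S V \<longleftrightarrow> S \<subseteq> carrier V \<and> \<zero>\<^bsub>V\<^esub> \<in> S \<and>
     (\<forall>x\<in>S. \<forall>y\<in>S. x \<oplus>\<^bsub>V\<^esub> y \<in> S) \<and> (\<forall>r. \<forall>x\<in>S. r \<odot>\<^bsub>V\<^esub> x \<in> S)"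

text \<open>
  The axioms pass to any surjective image, so every quotient and direct sum below becomes a
  vector space as soon as a linear surjection onto it is known.
\<close>
lemma linear_onto_vectorspace:
  assumes V: "vectorspace (class_ring :: real ring) V" and f: "linear_on V W f" and onto: "f ` carrier V = carrier W"
  shows "vectorspace (class_ring :: real ring) W"
proof -
  interpret V: vectorspace "class_ring :: real ring" V by fact
  have add: "f x \<oplus>\<^bsub>W\<^esub> f y = f (x \<oplus>\<^bsub>V\<^esub> y)" if "x \<in> carrier V" "y \<in> carrier V" for x y
    using f that by (simp add: linear_on_def)
  have sm: "r \<odot>\<^bsub>W\<^esub> f x = f (r \<odot>\<^bsub>V\<^esub> x)" if "x \<in> carrier V" for r x
    using f that by (simp add: linear_on_def)
  have z: "\<zero>\<^bsub>W\<^esub> = f \<zero>\<^bsub>V\<^esub>" using f by (simp add: linear_on_def)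
  have "module (class_ring :: real ring) W"
  proof (rule module_criteria)
    show "cring (class_ring :: real ring)" by (rule class_cring.is_cring)
  next
    show "\<forall>v\<in>carrier W. \<exists>neg_v\<in>carrier W. v \<oplus>\<^bsub>W\<^esub> neg_v = \<zero>\<^bsub>W\<^esub>"
      unfolding onto[symmetric] z
      by (auto simp: add) (metis V.M.add.inv_closed V.M.r_neg)
  qed (auto simp: onto[symmetric] z add sm V.M.a_ac V.smult_r_distr,
      auto simp: V.smult_assoc1[simplified] V.smult_l_distr[simplified] V.smult_one[simplified])
  then show ?thesis
    by (simp add: vectorspace_def class_field)
qed

lemma lin_subspace_vectorspace:
  assumes V: "vectorspace (class_ring :: real ring) V" and S: "lin_subspace S V"
  shows "vectorspace (class_ring :: real ring) (vsub V S)" "subspace (class_ring :: real ring) S V"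
proof -
  interpret V: vectorspace "class_ring :: real ring" V by fact
  show "subspace (class_ring :: real ring) S V"
    using S unfolding lin_subspace_def VectorSpace.subspace_def submodule_def
    by (auto simp: V.vectorspace_axioms V.module_axioms)
  then show "vectorspace (class_ring :: real ring) (vsub V S)"
    by (rule V.subspace_is_vs)
qed

text \<open>
  Independent subsets of the subspace are independent in the whole space, which bounds their size;
  a maximal one is a basis.
\<close>
lemma fin_dim_space_vsub:
  assumes V: "fin_dim_space V" and S: "lin_subspace S V"
  shows "fin_dim_space (vsub V S)"
proof -
  interpret V: vectorspace "class_ring :: real ring" V using V by (simp add: fin_dim_space_def)
  have fd: "V.fin_dim" using V by (simp add: fin_dim_space_def)
  note * = lin_subspace_vectorspace[OF V.vectorspace_axioms S]
  interpret S: vectorspace "class_ring :: real ring" "vsub V S" by (rule *(1))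
  have sub: "S \<subseteq> carrier V" using S by (simp add: lin_subspace_def)
  have sm: "submodule class_ring S V" using *(2) by (simp add: VectorSpace.subspace_def)
  have small: "finite A \<and> card A \<le> V.dim" if "A \<subseteq> S \<and> S.lin_indpt A" for A
  proof -
    have "V.lin_indpt A" using V.span_li_not_depend(2)[OF _ sm, of A] that by simp
    then show ?thesis using V.li_le_dim[OF fd, of A] that sub by blast
  qed
  have "S.lin_indpt {}" by (simp add: S.lin_dep_def)
  then obtain A where A: "finite A" "maximal A (\<lambda>B. B \<subseteq> S \<and> S.lin_indpt B)"
    using maximal_exists[of "\<lambda>B. B \<subseteq> S \<and> S.lin_indpt B" V.dim "{}"] small by auto
  then have "S.gen_set A" using S.max_li_is_gen[of A] by simp
  then show ?thesis using A *(1) unfolding fin_dim_space_def S.fin_dim_def maximal_def by auto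
qed

theorem rank_nullity_onto:
  assumes V: "fin_dim_space V" and f: "linear_on V W f" and onto: "f ` carrier V = carrier W"
  shows "fin_dim_space W" "rank V = rank W + rank (vsub V {x \<in> carrier V. f x = \<zero>\<^bsub>W\<^esub>})"
proof -
  have vsV: "vectorspace (class_ring :: real ring) V" and fd: "vectorspace.fin_dim (class_ring :: real ring) V"
    using V by (auto simp: fin_dim_space_def)
  have vsW: "vectorspace (class_ring :: real ring) W" by (rule linear_onto_vectorspace[OF vsV f onto])
  have lm: "linear_map (class_ring :: real ring) V W f"
    using vsV vsW f onto unfolding linear_map_def mod_hom_def mod_hom_axioms_def LinearCombinations.module_hom_def
      linear_on_def vectorspace_def by auto
  interpret linear_map "class_ring :: real ring" V W f by (rule lm)
  show "fin_dim_space W" using vsW rank_nullity_main(2)[OF fd onto] by (simp add: fin_dim_space_def)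
  show "rank V = rank W + rank (vsub V {x \<in> carrier V. f x = \<zero>\<^bsub>W\<^esub>})"
    using rank_nullity_main(1)[OF fd] surj_imp_imT_carrier[OF onto] by (simp add: ker_def)
qed

lemma lin_subspace_refl: "fin_dim_space V \<Longrightarrow> lin_subspace (carrier V) V"
proof -
  assume "fin_dim_space V"
  then interpret V: vectorspace "class_ring :: real ring" V by (simp add: fin_dim_space_def)
  show ?thesis by (auto simp: lin_subspace_def)
qed

lemma lin_subspace_vsub: "S \<subseteq> T \<Longrightarrow> lin_subspace S V \<Longrightarrow> lin_subspace S (vsub V T)"
  by (simp add: lin_subspace_def)

lemma quotient_simps [simp]:
  "add (quotient_module V S) = set_add V" "zero (quotient_module V S) = S"
  "carrier (quotient_module V S) = a_rcosets\<^bsub>V\<^esub> S"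
  by (simp_all add: quotient_module_def)

text \<open>
  Scalar multiplication of cosets is a union over representatives; all members of the union
  coincide, because each of them contains the multiple of a fixed representative.
\<close>
lemma coset_projection:
  assumes V: "fin_dim_space V" and S: "lin_subspace S V"
  shows "linear_on V (quotient_module V S) (\<lambda>x. S +>\<^bsub>V\<^esub> x)"
    and "(\<lambda>x. S +>\<^bsub>V\<^esub> x) ` carrier V = carrier (quotient_module V S)"
    and "x \<in> carrier V \<Longrightarrow> (S +>\<^bsub>V\<^esub> x = S) = (x \<in> S)"
proof -
  interpret V: vectorspace "class_ring :: real ring" V using V by (simp add: fin_dim_space_def)
  have sub: "S \<subseteq> carrier V" using S by (simp add: lin_subspace_def)
  have neg: "\<ominus>\<^bsub>V\<^esub> x \<in> S" if "x \<in> S" for x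
  proof -
    have "(-1 :: real) \<odot>\<^bsub>V\<^esub> x \<in> S" using that S by (simp add: lin_subspace_def)
    then show ?thesis using V.smult_minus_1[of x] that sub by (auto simp: class_ring_simps)
  qed
  have "abelian_subgroup S V"
  proof (rule abelian_subgroupI3)
    show "additive_subgroup S V"
      using S neg by (auto simp: additive_subgroup_def subgroup_def lin_subspace_def a_inv_def)
    show "abelian_group V" by (rule V.M.abelian_group_axioms)
  qed
  then interpret S: abelian_subgroup S V .
  have same: "S +>\<^bsub>V\<^esub> a = S +>\<^bsub>V\<^esub> b" if "a \<in> S +>\<^bsub>V\<^esub> b" "b \<in> carrier V" for a b
    using V.M.a_repr_independence[OF that S.a_subgroup] by simp
  show "(\<lambda>x. S +>\<^bsub>V\<^esub> x) ` carrier V = carrier (quotient_module V S)"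
    by (auto simp: A_RCOSETS_def')
  show ker: "(S +>\<^bsub>V\<^esub> x = S) = (x \<in> S)" if "x \<in> carrier V" for x
    using that V.M.a_coset_join1[OF _ that S.a_subgroup] V.M.a_coset_join2[OF that S.a_subgroup] by auto
  have "(\<Union>a\<in>S +>\<^bsub>V\<^esub> x. S +>\<^bsub>V\<^esub> (r \<odot>\<^bsub>V\<^esub> a)) = S +>\<^bsub>V\<^esub> (r \<odot>\<^bsub>V\<^esub> x)" if x: "x \<in> carrier V" for r x
  proof -
    have "S +>\<^bsub>V\<^esub> (r \<odot>\<^bsub>V\<^esub> a) = S +>\<^bsub>V\<^esub> (r \<odot>\<^bsub>V\<^esub> x)" if a: "a \<in> S +>\<^bsub>V\<^esub> x" for a
    proof -
      obtain s where s: "s \<in> S" "a = s \<oplus>\<^bsub>V\<^esub> x" using a by (auto simp: a_r_coset_def')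
      then have "r \<odot>\<^bsub>V\<^esub> a = (r \<odot>\<^bsub>V\<^esub> s) \<oplus>\<^bsub>V\<^esub> (r \<odot>\<^bsub>V\<^esub> x)"
        using V.smult_r_distr[of r s x] x sub by auto
      moreover have "r \<odot>\<^bsub>V\<^esub> s \<in> S" using s S by (simp add: lin_subspace_def)
      ultimately have "r \<odot>\<^bsub>V\<^esub> a \<in> S +>\<^bsub>V\<^esub> (r \<odot>\<^bsub>V\<^esub> x)" by (auto simp: a_r_coset_def')
      then show ?thesis using same x V.smult_closed by simp
    qed
    moreover have "x \<in> S +>\<^bsub>V\<^esub> x" by (rule S.a_rcos_self[OF x])
    ultimately show ?thesis by blast
  qed
  moreover have "S +>\<^bsub>V\<^esub> \<zero>\<^bsub>V\<^esub> = S" by (simp add: ker)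
  ultimately show "linear_on V (quotient_module V S) (\<lambda>x. S +>\<^bsub>V\<^esub> x)"
    using S.a_rcos_sum by (auto simp: linear_on_def quotient_module_def)
qed

corollary rank_quotient:
  assumes "fin_dim_space V" and "lin_subspace S V"
  shows "fin_dim_space (quotient_module V S)" "rank V = rank (quotient_module V S) + rank (vsub V S)"
proof -
  note * = coset_projection[OF assms]
  have "{x \<in> carrier V. S +>\<^bsub>V\<^esub> x = S} = S" using *(3) assms by (auto simp: lin_subspace_def)
  then show "fin_dim_space (quotient_module V S)" "rank V = rank (quotient_module V S) + rank (vsub V S)"
    using rank_nullity_onto[OF assms(1) *(1,2)] by simp_all
qed

corollary rank_mono:
  assumes "fin_dim_space V" "lin_subspace S V" shows "rank (vsub V S) \<le> rank V"
  using rank_quotient(2)[OF assms] by simp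

lemma linear_on_image_kernel:
  assumes V: "fin_dim_space V" and W: "fin_dim_space W" and f: "linear_on V W f" and im: "f ` carrier V \<subseteq> carrier W"
  shows "lin_subspace (f ` carrier V) W" "lin_subspace {x \<in> carrier V. f x = \<zero>\<^bsub>W\<^esub>} V"
proof -
  interpret V: vectorspace "class_ring :: real ring" V using V by (simp add: fin_dim_space_def)
  interpret W: vectorspace "class_ring :: real ring" W using W by (simp add: fin_dim_space_def)
  have add: "f x \<oplus>\<^bsub>W\<^esub> f y = f (x \<oplus>\<^bsub>V\<^esub> y)" if "x \<in> carrier V" "y \<in> carrier V" for x y
    using f that by (simp add: linear_on_def)
  have sm: "r \<odot>\<^bsub>W\<^esub> f x = f (r \<odot>\<^bsub>V\<^esub> x)" if "x \<in> carrier V" for r x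
    using f that by (simp add: linear_on_def)
  have z: "\<zero>\<^bsub>W\<^esub> = f \<zero>\<^bsub>V\<^esub>" using f by (simp add: linear_on_def)
  show "lin_subspace (f ` carrier V) W"
    using im by (auto simp: lin_subspace_def add sm z)
  show "lin_subspace {x \<in> carrier V. f x = \<zero>\<^bsub>W\<^esub>} V"
    using f V.smult_closed W.smult_r_null by (auto simp: lin_subspace_def linear_on_def)
qed

theorem rank_nullity_into:
  assumes V: "fin_dim_space V" and W: "fin_dim_space W" and f: "linear_on V W f" and im: "f ` carrier V \<subseteq> carrier W"
  shows "rank V = rank (vsub W (f ` carrier V)) + rank (vsub V {x \<in> carrier V. f x = \<zero>\<^bsub>W\<^esub>})"
proof -
  have "linear_on V (vsub W (f ` carrier V)) f" using f by (simp add: linear_on_def)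
  from rank_nullity_onto(2)[OF V this] show ?thesis by simp
qed

text \<open>
  The kernel of \<open>d\<close> has rank \<open>rank V - rank (im d)\<close>, and passing to homology removes
  \<open>rank (im d)\<close> once more.
\<close>
theorem rank_homology:
  assumes V: "fin_dim_space V" and d: "linear_on V V d" and im: "d ` carrier V \<subseteq> carrier V"
    and dd: "\<And>x. x \<in> carrier V \<Longrightarrow> d (d x) = \<zero>\<^bsub>V\<^esub>"
  shows "rank (quotient_module (vsub V (a_kernel V V d)) (d ` carrier V))
           + 2 * rank (vsub V (d ` carrier V)) = rank V"
proof -
  have k: "a_kernel V V d = {x \<in> carrier V. d x = \<zero>\<^bsub>V\<^esub>}" by (simp add: a_kernel_def')
  note * = linear_on_image_kernel[OF V V d im]
  have "lin_subspace (d ` carrier V) (vsub V (a_kernel V V d))"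
    using * im dd by (intro lin_subspace_vsub) (auto simp: k)
  from rank_quotient(2)[OF _ this] fin_dim_space_vsub[OF V *(2)]
  have "rank (vsub V (a_kernel V V d)) =
    rank (quotient_module (vsub V (a_kernel V V d)) (d ` carrier V)) + rank (vsub V (d ` carrier V))"
    by (simp add: k)
  with rank_nullity_into[OF V V d im] show ?thesis by (simp add: k)
qed

definition real_line :: "(real, real) module" where
  "real_line = \<lparr>carrier = UNIV, mult = (*), one = 1, zero = 0, add = (+), smult = (*)\<rparr>"

lemma real_line_simps [simp]:
  "carrier real_line = UNIV" "zero real_line = 0" "add real_line = (+)" "smult real_line = (*)"
  by (simp_all add: real_line_def)

lemma real_line_rank: "rank real_line = 1"
proof -
  have "module (class_ring :: real ring) real_line"
    by (rule module_criteria) (auto simp: algebra_simps class_cring.is_cring intro: exI[of _ "- _"])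
  then interpret R: vectorspace "class_ring :: real ring" real_line
    by (simp add: vectorspace_def class_field)
  have "R.gen_set {1}"
    unfolding R.finite_span[of "{1}", simplified]
    by (auto simp: R.lincomb_def)
  then show ?thesis by (intro R.dim1I) auto
qed

text \<open>
  A functional is onto the real line unless it vanishes identically.
\<close>
theorem rank_functional:
  assumes V: "fin_dim_space V" and f: "linear_on V real_line f"
  shows "rank V = rank (vsub V {x \<in> carrier V. f x = 0}) + (if \<exists>x\<in>carrier V. f x \<noteq> 0 then 1 else 0)"
proof (cases "\<exists>x\<in>carrier V. f x \<noteq> 0")
  case True
  interpret V: vectorspace "class_ring :: real ring" V using V by (simp add: fin_dim_space_def)
  from True obtain x where x: "x \<in> carrier V" "f x \<noteq> 0" by blast
  have "f ((c / f x) \<odot>\<^bsub>V\<^esub> x) = c" for c using f x by (simp add: linear_on_def)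
  moreover have "(c / f x) \<odot>\<^bsub>V\<^esub> x \<in> carrier V" for c using x V.smult_closed by simp
  ultimately have "c \<in> f ` carrier V" for c by (metis imageI)
  then have "f ` carrier V = carrier real_line" by auto
  from rank_nullity_onto(2)[OF V f this] show ?thesis using True by (simp add: real_line_rank)
next
  case False
  then have "{x \<in> carrier V. f x = 0} = carrier V" by auto
  then show ?thesis using False by simp
qed

section \<open>Spaces of real functions\<close>

text \<open>
  Subspaces of real functions are determined by their carrier alone, which makes ranks of images,
  kernels and intersections of subsets comparable without changing the ambient space.
\<close>
definition fun_space :: "('a \<Rightarrow> real) set \<Rightarrow> (real, 'a \<Rightarrow> real) module" where
  "fun_space S = \<lparr>carrier = S, mult = (\<lambda>x y p. 0), one = (\<lambda>p. 0), zero = (\<lambda>p. 0),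
     add = (\<lambda>x y p. x p + y p), smult = (\<lambda>r x p. r * x p)\<rparr>"

lemma fun_space_simps [simp]:
  "carrier (fun_space S) = S" "zero (fun_space S) = (\<lambda>p. 0)" "add (fun_space S) = (\<lambda>x y p. x p + y p)"
  "smult (fun_space S) = (\<lambda>r x p. r * x p)" "vsub (fun_space S) T = fun_space T"
  by (simp_all add: fun_space_def)

definition supported :: "'a set \<Rightarrow> ('a \<Rightarrow> real) set" where
  "supported P = {x. \<forall>p. p \<notin> P \<longrightarrow> x p = 0}"

definition pointwise_linear :: "(('a \<Rightarrow> real) \<Rightarrow> ('b \<Rightarrow> real)) \<Rightarrow> bool" where
  "pointwise_linear f \<longleftrightarrow> (\<forall>x y. f (\<lambda>p. x p + y p) = (\<lambda>p. f x p + f y p)) \<and>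
     (\<forall>r x. f (\<lambda>p. r * x p) = (\<lambda>p. r * f x p))"

lemma pointwise_linearD:
  assumes "pointwise_linear f"
  shows "f (\<lambda>p. x p + y p) = (\<lambda>p. f x p + f y p)" "f (\<lambda>p. r * x p) = (\<lambda>p. r * f x p)"
    "f (\<lambda>p. 0) = (\<lambda>p. 0)"
proof -
  show a: "f (\<lambda>p. x p + y p) = (\<lambda>p. f x p + f y p)" and s: "f (\<lambda>p. r * x p) = (\<lambda>p. r * f x p)" for x y r
    using assms by (simp_all add: pointwise_linear_def)
  show "f (\<lambda>p. 0) = (\<lambda>p. 0)" using s[of 0 "\<lambda>p. 0"] by simp
qed

lemma pointwise_linear_on: "pointwise_linear f \<Longrightarrow> linear_on (fun_space S) (fun_space T) f"
  by (simp add: linear_on_def pointwise_linearD)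

text \<open>
  The indicator functions of the points of \<open>P\<close> span, by induction on the support.
\<close>
lemma supported_fin_dim_space:
  fixes P :: "'a set"
  assumes "finite P"
  shows "fin_dim_space (fun_space (supported P))"
proof -
  have "\<exists>y\<in>supported P. (\<lambda>p. x p + y p) = (\<lambda>p. 0)" if "x \<in> supported P" for x :: "'a \<Rightarrow> real"
    using that by (intro bexI[of _ "\<lambda>p. - x p"]) (auto simp: supported_def)
  then have "module (class_ring :: real ring) (fun_space (supported P))"
    by (intro module_criteria) (auto simp: algebra_simps supported_def class_cring.is_cring)
  then interpret V: vectorspace "class_ring :: real ring" "fun_space (supported P)"
    by (simp add: vectorspace_def class_field)
  define e :: "'a \<Rightarrow> 'a \<Rightarrow> real" where "e q = (\<lambda>p. if p = q then 1 else 0)" for q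
  have eP: "e ` P \<subseteq> carrier (fun_space (supported P))" by (auto simp: e_def supported_def)
  interpret S: submodule "class_ring :: real ring" "V.span (e ` P)" "fun_space (supported P)"
    by (rule V.span_is_submodule[OF eP])
  have "supported Q \<subseteq> V.span (e ` P)" if "finite Q" "Q \<subseteq> P" for Q
    using that
  proof (induction Q rule: finite_induct)
    case empty
    have "supported {} = {\<lambda>p :: 'a. 0 :: real}" by (auto simp: supported_def)
    then show ?case using S.zero_closed by simp
  next
    case (insert q Q)
    show ?case
    proof
      fix x :: "'a \<Rightarrow> real" assume x: "x \<in> supported (insert q Q)"
      have "x(q := 0) \<in> V.span (e ` P)" using insert x by (auto simp: supported_def)
      moreover have "e q \<in> V.span (e ` P)" using insert.prems V.in_own_span[OF eP] by auto
      then have "(\<lambda>p. x q * e q p) \<in> V.span (e ` P)" using S.smult_closed[of "x q" "e q"] by simp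
      ultimately have "(\<lambda>p. (x(q := 0)) p + x q * e q p) \<in> V.span (e ` P)"
        using S.m_closed by fastforce
      moreover have "(\<lambda>p. (x(q := 0)) p + x q * e q p) = x" by (auto simp: e_def)
      ultimately show "x \<in> V.span (e ` P)" by simp
    qed
  qed
  from this[OF assms] have "V.gen_set (e ` P)" using S.subset by auto
  then show ?thesis unfolding fin_dim_space_def V.fin_dim_def
    using V.vectorspace_axioms assms eP by blast
qed

abbreviation fun_rank :: "('a \<Rightarrow> real) set \<Rightarrow> nat" where "fun_rank S \<equiv> rank (fun_space S)"

definition fun_subspace :: "('a \<Rightarrow> real) set \<Rightarrow> bool" where
  "fun_subspace S \<longleftrightarrow> (\<lambda>p. 0) \<in> S \<and> (\<forall>x\<in>S. \<forall>y\<in>S. (\<lambda>p. x p + y p) \<in> S) \<and> (\<forall>r. \<forall>x\<in>S. (\<lambda>p. r * x p) \<in> S)"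

lemma lin_subspace_fun_space [simp]: "lin_subspace S (fun_space T) \<longleftrightarrow> S \<subseteq> T \<and> fun_subspace S"
  by (auto simp: lin_subspace_def fun_subspace_def)

lemma fun_subspace_fin_dim_space: "fin_dim_space (fun_space T) \<Longrightarrow> S \<subseteq> T \<Longrightarrow> fun_subspace S \<Longrightarrow> fin_dim_space (fun_space S)"
  using fin_dim_space_vsub[of "fun_space T" S] by simp

lemma fun_subspace_supported: "fun_subspace (supported P)"
  by (auto simp: fun_subspace_def supported_def)

lemma fun_subspace_image: 
  assumes f: "pointwise_linear f" and S: "fun_subspace S" shows "fun_subspace (f ` S)"
proof -
  have "(\<lambda>p. 0) \<in> f ` S" using S pointwise_linearD(3)[OF f] by (metis fun_subspace_def imageI)
  moreover have "(\<lambda>p. f x p + f y p) \<in> f ` S" if "x \<in> S" "y \<in> S" for x y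
    using S that pointwise_linearD(1)[OF f, of x y] by (metis fun_subspace_def imageI)
  moreover have "(\<lambda>p. r * f x p) \<in> f ` S" if "x \<in> S" for x r
    using S that pointwise_linearD(2)[OF f, of r x] by (metis fun_subspace_def imageI)
  ultimately show ?thesis by (auto simp: fun_subspace_def)
qed

lemma fun_subspace_kernel:
  "pointwise_linear f \<Longrightarrow> fun_subspace S \<Longrightarrow> fun_subspace {x \<in> S. f x = (\<lambda>p. 0)}"
  by (auto simp: fun_subspace_def pointwise_linearD)

lemma fun_subspace_Int: "fun_subspace S \<Longrightarrow> fun_subspace T \<Longrightarrow> fun_subspace (S \<inter> T)"
  by (auto simp: fun_subspace_def)

lemma fun_subspace_sum:
  assumes "fun_subspace S" "fun_subspace T"
  shows "fun_subspace {(\<lambda>p. x p + y p) | x y. x \<in> S \<and> y \<in> T}"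
  unfolding fun_subspace_def
proof (intro conjI ballI allI)
  show "(\<lambda>p. 0) \<in> {(\<lambda>p. x p + y p) | x y. x \<in> S \<and> y \<in> T}"
    using assms by (intro CollectI exI[of _ "\<lambda>p. 0"]) (auto simp: fun_subspace_def)
next
  fix a b assume "a \<in> {(\<lambda>p. x p + y p) | x y. x \<in> S \<and> y \<in> T}" "b \<in> {(\<lambda>p. x p + y p) | x y. x \<in> S \<and> y \<in> T}"
  then obtain x y x' y' where *: "a = (\<lambda>p. x p + y p)" "b = (\<lambda>p. x' p + y' p)" "x \<in> S" "x' \<in> S" "y \<in> T" "y' \<in> T" by blast
  have "(\<lambda>p. a p + b p) = (\<lambda>p. (\<lambda>p. x p + x' p) p + (\<lambda>p. y p + y' p) p)" using * by auto
  then show "(\<lambda>p. a p + b p) \<in> {(\<lambda>p. x p + y p) | x y. x \<in> S \<and> y \<in> T}" using * assms 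
    by (intro CollectI exI[of _ "\<lambda>p. x p + x' p"] exI[of _ "\<lambda>p. y p + y' p"]) (auto simp: fun_subspace_def)
next
  fix r a assume "a \<in> {(\<lambda>p. x p + y p) | x y. x \<in> S \<and> y \<in> T}"
  then obtain x y where *: "a = (\<lambda>p. x p + y p)" "x \<in> S" "y \<in> T" by blast
  then show "(\<lambda>p. r * a p) \<in> {(\<lambda>p. x p + y p) | x y. x \<in> S \<and> y \<in> T}" using assms 
    by (intro CollectI exI[of _ "\<lambda>p. r * x p"] exI[of _ "\<lambda>p. r * y p"]) (auto simp: fun_subspace_def distrib_left)
qed

corollary fun_rank_nullity:
  assumes "fin_dim_space (fun_space S)" "pointwise_linear f"
  shows "fun_rank S = fun_rank (f ` S) + fun_rank {x \<in> S. f x = (\<lambda>p. 0)}"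
  using rank_nullity_onto(2)[OF assms(1) pointwise_linear_on[OF assms(2)], of "f ` S"] by simp

section \<open>Signs\<close>

lemma eps_square [simp]: "eps v I * eps v I = 1"
  by (simp add: eps_def power_add[symmetric])

lemma eps_nonzero [simp]: "eps v I \<noteq> 0"
  by (simp add: eps_def)

text \<open>
  The one sign rule behind every \<open>d\<^sup>2 = 0\<close> and every anticommutation below: deleting the smaller of two
  vertices first shifts the position of the larger one by one.
\<close>
lemma eps_swap:
  assumes "finite I" "v \<in> I" "w \<in> I" "v \<noteq> w"
  shows "eps v I * eps w (I - {v}) = - (eps w I * eps v (I - {w}))"
proof -
  have *: "eps a I * eps b (I - {a}) = - (eps b I * eps a (I - {b}))" if "a \<in> I" "b \<in> I" "a < b" for a b
  proof -
    have "{l \<in> I. l < b} = insert a {l \<in> I - {a}. l < b}" using that by auto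
    then have "card {l \<in> I. l < b} = Suc (card {l \<in> I - {a}. l < b})"
      using assms(1) by simp
    moreover have "{l \<in> I - {b}. l < a} = {l \<in> I. l < a}" using that by auto
    ultimately show ?thesis by (simp add: eps_def)
  qed
  show ?thesis
  proof (cases "v < w")
    case True then show ?thesis using *[of v w] assms by simp
  next
    case False then show ?thesis using *[of w v] assms by simp
  qed
qed

lemma antisymmetric_sum_zero:
  fixes g :: "'a \<Rightarrow> 'a \<Rightarrow> real"
  assumes "finite I" and "\<And>v w. v \<in> I \<Longrightarrow> w \<in> I \<Longrightarrow> v \<noteq> w \<Longrightarrow> g v w = - g w v"
  shows "(\<Sum>v\<in>I. \<Sum>w\<in>I - {v}. g v w) = 0"
proof -
  have "(\<Sum>v\<in>I. \<Sum>w\<in>I - {v}. g v w) = (\<Sum>(v, w)\<in>(SIGMA v:I. I - {v}). g v w)"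
    using assms(1) by (subst sum.Sigma) auto
  also have "\<dots> = (\<Sum>(v, w)\<in>(SIGMA v:I. I - {v}). g w v)"
    by (rule sum.reindex_bij_witness[of _ "\<lambda>(v, w). (w, v)" "\<lambda>(v, w). (w, v)"]) auto
  also have "\<dots> = (\<Sum>(v, w)\<in>(SIGMA v:I. I - {v}). - g v w)"
    using assms(2) by (intro sum.cong) auto
  also have "\<dots> = - (\<Sum>(v, w)\<in>(SIGMA v:I. I - {v}). g v w)"
    by (simp add: sum_negf case_prod_beta)
  also have "\<dots> = - (\<Sum>v\<in>I. \<Sum>w\<in>I - {v}. g v w)"
    using assms(1) by (subst sum.Sigma) auto
  finally show ?thesis by simp
qed

text \<open>
  Deleting \<open>v\<close> and \<open>w\<close> in the two possible orders gives the same face with opposite signs.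
\<close>
lemma coboundary_square_sum:
  assumes "finite \<tau>"
  shows "(\<Sum>v\<in>\<tau>. eps v \<tau> * (\<Sum>w\<in>\<tau> - {v}. eps w (\<tau> - {v}) * F (\<tau> - {v} - {w}))) = 0"
proof -
  have "(\<Sum>v\<in>\<tau>. \<Sum>w\<in>\<tau> - {v}. eps v \<tau> * eps w (\<tau> - {v}) * F (\<tau> - {v} - {w})) = 0"
  proof (rule antisymmetric_sum_zero[OF assms])
    fix v w assume vw: "v \<in> \<tau>" "w \<in> \<tau>" "v \<noteq> w"
    have "\<tau> - {v} - {w} = \<tau> - {w} - {v}" by blast
    then show "eps v \<tau> * eps w (\<tau> - {v}) * F (\<tau> - {v} - {w}) = - (eps w \<tau> * eps v (\<tau> - {w}) * F (\<tau> - {w} - {v}))"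
      by (simp only: eps_swap[OF assms vw] mult_minus_left)
  qed
  then show ?thesis by (simp add: sum_distrib_left mult.assoc)
qed

section \<open>Reduced cohomology\<close>

definition finite_complex :: "nat set set \<Rightarrow> bool" where
  "finite_complex L \<longleftrightarrow> finite L \<and> (\<forall>\<tau>\<in>L. finite \<tau>) \<and> (\<forall>\<tau>\<in>L. \<forall>\<rho>\<subseteq>\<tau>. \<rho> \<in> L)"

lemma cochains_simps [simp]:
  "carrier (cochains L p) = simplices L p \<rightarrow>\<^sub>E UNIV"
  "zero (cochains L p) = (\<lambda>\<tau>\<in>simplices L p. 0)"
  "add (cochains L p) = (\<lambda>f g. \<lambda>\<tau>\<in>simplices L p. f \<tau> + g \<tau>)"
  "smult (cochains L p) = (\<lambda>c f. \<lambda>\<tau>\<in>simplices L p. c * f \<tau>)"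
  by (simp_all add: class_ring.func_space_def)

lemma finite_simplices: "finite_complex L \<Longrightarrow> finite (simplices L p)"
  by (simp add: finite_complex_def simplices_def)

lemma simplices_face: "finite_complex L \<Longrightarrow> \<tau> \<in> simplices L (p + 1) \<Longrightarrow> v \<in> \<tau> \<Longrightarrow> \<tau> - {v} \<in> simplices L p"
  using card_Suc_Diff1[of \<tau> v] by (auto simp: finite_complex_def simplices_def)

lemma cochains_fin_dim_space:
  assumes "finite_complex L"
  shows "fin_dim_space (cochains L p)"
proof (rule rank_nullity_onto(1)[OF supported_fin_dim_space[OF finite_simplices[OF assms]]])
  show "linear_on (fun_space (supported (simplices L p))) (cochains L p) (\<lambda>f. restrict f (simplices L p))"
    by (auto simp: linear_on_def restrict_def)
  show "(\<lambda>f. restrict f (simplices L p)) ` carrier (fun_space (supported (simplices L p))) = carrier (cochains L p)"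
  proof
    show "carrier (cochains L p) \<subseteq> (\<lambda>f. restrict f (simplices L p)) ` carrier (fun_space (supported (simplices L p)))"
    proof
      fix f assume "f \<in> carrier (cochains L p)"
      then have "f = restrict (\<lambda>\<tau>. if \<tau> \<in> simplices L p then f \<tau> else 0) (simplices L p)"
        by (auto simp: PiE_def extensional_def)
      then show "f \<in> (\<lambda>f. restrict f (simplices L p)) ` carrier (fun_space (supported (simplices L p)))"
        by (auto simp: supported_def)
    qed
  qed auto
qed

lemma coboundary_linear:
  assumes "finite_complex L"
  shows "linear_on (cochains L p) (cochains L (p + 1)) (coboundary L p)"
    "coboundary L p ` carrier (cochains L p) \<subseteq> carrier (cochains L (p + 1))"
proof -
  note face = simplices_face[OF assms]
  show "linear_on (cochains L p) (cochains L (p + 1)) (coboundary L p)"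
    unfolding linear_on_def
    by (simp add: coboundary_def fun_eq_iff face distrib_left sum.distrib sum_distrib_left mult.left_commute)
  show "coboundary L p ` carrier (cochains L p) \<subseteq> carrier (cochains L (p + 1))"
    by (auto simp: coboundary_def)
qed

lemma coboundary_coboundary:
  assumes "finite_complex L"
  shows "coboundary L (p + 1) (coboundary L p f) = (\<lambda>\<tau>\<in>simplices L (p + 1 + 1). 0)"
proof
  fix \<tau>
  have "(\<Sum>v\<in>\<tau>. eps v \<tau> * coboundary L p f (\<tau> - {v})) = 0" if \<tau>: "\<tau> \<in> simplices L (p + 1 + 1)"
  proof -
    have "(\<Sum>v\<in>\<tau>. eps v \<tau> * coboundary L p f (\<tau> - {v}))
        = (\<Sum>v\<in>\<tau>. eps v \<tau> * (\<Sum>w\<in>\<tau> - {v}. eps w (\<tau> - {v}) * f (\<tau> - {v} - {w})))"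
      using simplices_face[OF assms \<tau>] by (intro sum.cong) (auto simp: coboundary_def)
    also have "\<dots> = 0"
      using \<tau> assms by (intro coboundary_square_sum) (auto simp: simplices_def finite_complex_def)
    finally show ?thesis .
  qed
  then show "coboundary L (p + 1) (coboundary L p f) \<tau> = (\<lambda>\<tau>\<in>simplices L (p + 1 + 1). 0) \<tau>"
    by (simp add: coboundary_def)
qed

lemma cocycles_iff:
  "f \<in> cocycles L p \<longleftrightarrow> f \<in> carrier (cochains L p) \<and>
     (\<forall>\<tau>\<in>simplices L (p + 1). (\<Sum>v\<in>\<tau>. eps v \<tau> * f (\<tau> - {v})) = 0)"
proof -
  have "coboundary L p f = (\<lambda>\<tau>\<in>simplices L (p + 1). 0) \<longleftrightarrow>
      (\<forall>\<tau>\<in>simplices L (p + 1). (\<Sum>v\<in>\<tau>. eps v \<tau> * f (\<tau> - {v})) = 0)" (is "?l \<longleftrightarrow> ?r")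
  proof
    assume ?l
    then have "coboundary L p f \<tau> = 0" if "\<tau> \<in> simplices L (p + 1)" for \<tau>
      using that by simp
    then show ?r by (simp add: coboundary_def)
  next
    assume ?r
    then show ?l unfolding coboundary_def by (intro restrict_ext) blast
  qed
  then show ?thesis by (simp add: cocycles_def a_kernel_def')
qed

lemma vsub_simps:
  "carrier (vsub V S) = S" "zero (vsub V S) = zero V" "vsub (vsub V S) T = vsub V T"
  by simp_all

lemma cocycles_subspace:
  assumes "finite_complex L"
  shows "lin_subspace (cocycles L p) (cochains L p)"
  using linear_on_image_kernel(2)[OF cochains_fin_dim_space[OF assms] cochains_fin_dim_space[OF assms] coboundary_linear[OF assms, of p]]
  by (simp only: cocycles_def a_kernel_def')

lemma cocycles_closed:
  assumes "finite_complex L" "f \<in> cocycles L p" "g \<in> cocycles L p"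
  shows "(\<lambda>\<tau>\<in>simplices L p. f \<tau> + g \<tau>) \<in> cocycles L p"
    "(\<lambda>\<tau>\<in>simplices L p. r * f \<tau>) \<in> cocycles L p"
  using cocycles_subspace[OF assms(1), of p] assms(2,3) by (simp_all add: lin_subspace_def)

lemma cocycles_fin_dim_space: "finite_complex L \<Longrightarrow> fin_dim_space (vsub (cochains L p) (cocycles L p))"
  by (intro fin_dim_space_vsub cochains_fin_dim_space cocycles_subspace)

lemma coboundaries_subspace:
  assumes "finite_complex L"
  shows "lin_subspace (coboundaries L p) (vsub (cochains L p) (cocycles L p))"
proof (rule lin_subspace_vsub)
  show "lin_subspace (coboundaries L p) (cochains L p)"
    using linear_on_image_kernel(1)[OF cochains_fin_dim_space[OF assms] cochains_fin_dim_space[OF assms] coboundary_linear[OF assms, of "p - 1"]]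
    by (simp only: coboundaries_def diff_add_cancel)
  then show "coboundaries L p \<subseteq> cocycles L p"
    using coboundary_coboundary[OF assms, of "p - 1"]
    by (auto simp: coboundaries_def cocycles_def a_kernel_def' lin_subspace_def)
qed

definition cohom_class :: "nat set set \<Rightarrow> int \<Rightarrow> (nat set \<Rightarrow> real) \<Rightarrow> (nat set \<Rightarrow> real) set" where
  "cohom_class L p f = coboundaries L p +>\<^bsub>cochains L p\<^esub> f"

lemma zero_red_cohom [simp]: "zero (red_cohom L p) = coboundaries L p"
  by (simp add: red_cohom_def)

lemma cohom_class_linear:
  assumes "finite_complex L"
  shows "linear_on (vsub (cochains L p) (cocycles L p)) (red_cohom L p) (cohom_class L p)"
    "cohom_class L p ` cocycles L p = carrier (red_cohom L p)"
    "f \<in> cocycles L p \<Longrightarrow> cohom_class L p f = coboundaries L p \<longleftrightarrow> f \<in> coboundaries L p"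
proof -
  have c: "cohom_class L p = (\<lambda>f. coboundaries L p +>\<^bsub>vsub (cochains L p) (cocycles L p)\<^esub> f)"
    by (simp add: cohom_class_def a_r_coset_def' fun_eq_iff del: cochains_simps)
  note * = coset_projection[OF cocycles_fin_dim_space[OF assms, of p] coboundaries_subspace[OF assms, of p]]
  show "linear_on (vsub (cochains L p) (cocycles L p)) (red_cohom L p) (cohom_class L p)"
    using *(1) by (simp only: c red_cohom_def) 
  show "cohom_class L p ` cocycles L p = carrier (red_cohom L p)"
    using *(2) by (simp only: c red_cohom_def vsub_simps)
  show "f \<in> cocycles L p \<Longrightarrow> cohom_class L p f = coboundaries L p \<longleftrightarrow> f \<in> coboundaries L p"
    using *(3) by (simp only: c vsub_simps)
qed

lemma red_cohom_rank:
  assumes "finite_complex L"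
  shows "fin_dim_space (red_cohom L p)"
    "rank (vsub (cochains L p) (cocycles L p)) = rank (red_cohom L p) + rank (vsub (cochains L p) (coboundaries L p))"
  using rank_quotient[OF cocycles_fin_dim_space[OF assms, of p] coboundaries_subspace[OF assms, of p]]
  by (simp_all only: red_cohom_def vsub_simps)


section \<open>Restriction to subcomplexes\<close>

lemma linear_on_cohom_class:
  assumes "finite_complex L" "f \<in> cocycles L p" "g \<in> cocycles L p"
  shows "cohom_class L p (\<lambda>\<tau>\<in>simplices L p. f \<tau> + g \<tau>) = cohom_class L p f \<oplus>\<^bsub>red_cohom L p\<^esub> cohom_class L p g"
    "cohom_class L p (\<lambda>\<tau>\<in>simplices L p. r * f \<tau>) = r \<odot>\<^bsub>red_cohom L p\<^esub> cohom_class L p f"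
  using cohom_class_linear(1)[OF assms(1), of p] assms(2,3) by (simp_all add: linear_on_def)

lemma cohom_class_cong_coboundary:
  assumes L: "finite_complex L" and b: "b \<in> coboundaries L p" and f: "f \<in> cocycles L p"
  shows "cohom_class L p (\<lambda>\<tau>\<in>simplices L p. b \<tau> + f \<tau>) = cohom_class L p f"
proof -
  interpret R: vectorspace "class_ring :: real ring" "red_cohom L p"
    using red_cohom_rank(1)[OF L] by (simp add: fin_dim_space_def)
  have bc: "b \<in> cocycles L p" using coboundaries_subspace[OF L, of p] b by (auto simp: lin_subspace_def)
  have "cohom_class L p (\<lambda>\<tau>\<in>simplices L p. b \<tau> + f \<tau>) = cohom_class L p b \<oplus>\<^bsub>red_cohom L p\<^esub> cohom_class L p f"
    by (rule linear_on_cohom_class(1)[OF L bc f])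
  also have "cohom_class L p b = zero (red_cohom L p)"
    using cohom_class_linear(3)[OF L bc] b by simp
  also have "\<dots> \<oplus>\<^bsub>red_cohom L p\<^esub> cohom_class L p f = cohom_class L p f"
    using cohom_class_linear(2)[OF L, of p] f by (intro R.M.l_zero) auto
  finally show ?thesis .
qed

lemma simplices_mono: "L' \<subseteq> L \<Longrightarrow> simplices L' p \<subseteq> simplices L p"
  by (auto simp: simplices_def)

lemma restrict_cocycle:
  assumes L': "finite_complex L'" "L' \<subseteq> L" and f: "f \<in> cocycles L p"
  shows "restrict f (simplices L' p) \<in> cocycles L' p"
proof -
  have "(\<Sum>v\<in>\<tau>. eps v \<tau> * restrict f (simplices L' p) (\<tau> - {v})) = 0" if \<tau>: "\<tau> \<in> simplices L' (p + 1)" for \<tau>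
  proof -
    have "(\<Sum>v\<in>\<tau>. eps v \<tau> * restrict f (simplices L' p) (\<tau> - {v})) = (\<Sum>v\<in>\<tau>. eps v \<tau> * f (\<tau> - {v}))"
      using simplices_face[OF L'(1) \<tau>] by (intro sum.cong) auto
    then show ?thesis using f \<tau> simplices_mono[OF L'(2)] by (auto simp: cocycles_iff)
  qed
  then show ?thesis by (simp add: cocycles_iff)
qed

lemma restrict_coboundary:
  assumes L': "finite_complex L'" "L' \<subseteq> L" and b: "b \<in> coboundaries L p"
  shows "restrict b (simplices L' p) \<in> coboundaries L' p"
proof -
  obtain h where h: "b = coboundary L (p - 1) h" using b by (auto simp: coboundaries_def)
  have "restrict b (simplices L' p) = coboundary L' (p - 1) (restrict h (simplices L' (p - 1)))"
  proof
    fix \<tau>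
    show "restrict b (simplices L' p) \<tau> = coboundary L' (p - 1) (restrict h (simplices L' (p - 1))) \<tau>"
      using simplices_face[OF L'(1), of \<tau> "p - 1"] simplices_mono[OF L'(2), of p]
      by (auto simp: h coboundary_def intro!: sum.cong)
  qed
  then show ?thesis by (auto simp: coboundaries_def)
qed

text \<open>
  The union defining the restriction of a class consists of a single class: representatives differ by
  coboundaries, and coboundaries restrict to coboundaries.
\<close>
lemma restr_cohom_cohom_class:
  assumes L: "finite_complex L" and L': "finite_complex L'" "L' \<subseteq> L" and f: "f \<in> cocycles L p"
  shows "restr_cohom L' p (cohom_class L p f) = cohom_class L' p (restrict f (simplices L' p))"
proof -
  have "cohom_class L' p (restrict g (simplices L' p)) = cohom_class L' p (restrict f (simplices L' p))" if g: "g \<in> cohom_class L p f" for g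
  proof -
    obtain b where b: "b \<in> coboundaries L p" "g = (\<lambda>\<tau>\<in>simplices L p. b \<tau> + f \<tau>)"
      using g by (auto simp: cohom_class_def a_r_coset_def')
    have "restrict g (simplices L' p) = (\<lambda>\<tau>\<in>simplices L' p. restrict b (simplices L' p) \<tau> + restrict f (simplices L' p) \<tau>)"
      using simplices_mono[OF L'(2), of p] by (auto simp: b(2) restrict_def fun_eq_iff)
    then show ?thesis
      using cohom_class_cong_coboundary[OF L'(1) restrict_coboundary[OF L' b(1)] restrict_cocycle[OF L' f]] by simp
  qed
  moreover have "cohom_class L p f \<noteq> {}"
  proof -
    have "coboundaries L p \<noteq> {}" using coboundaries_subspace[OF L, of p] by (auto simp: lin_subspace_def)
    then show ?thesis by (auto simp: cohom_class_def a_r_coset_def')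
  qed
  ultimately show ?thesis unfolding restr_cohom_def cohom_class_def[symmetric] by auto
qed

lemma cohom_class_zero:
  assumes L: "finite_complex L"
  shows "cohom_class L p (\<lambda>\<tau>\<in>simplices L p. 0) = zero (red_cohom L p)"
proof -
  have "(\<lambda>\<tau>\<in>simplices L p. 0) \<in> coboundaries L p" "coboundaries L p \<subseteq> cocycles L p"
    using coboundaries_subspace[OF L, of p] by (simp_all add: lin_subspace_def)
  then show ?thesis using cohom_class_linear(3)[OF L, of "\<lambda>\<tau>\<in>simplices L p. 0" p] by (auto simp only: zero_red_cohom)
qed

lemma finsum_cohom_class:
  assumes L: "finite_complex L" and A: "finite A" and g: "\<And>i. i \<in> A \<Longrightarrow> g i \<in> cocycles L p"
  shows "(\<lambda>\<tau>\<in>simplices L p. \<Sum>i\<in>A. c i * g i \<tau>) \<in> cocycles L p \<and>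
    (\<Oplus>\<^bsub>red_cohom L p\<^esub> i\<in>A. c i \<odot>\<^bsub>red_cohom L p\<^esub> cohom_class L p (g i)) = cohom_class L p (\<lambda>\<tau>\<in>simplices L p. \<Sum>i\<in>A. c i * g i \<tau>)"
  using A g
proof (induction A rule: finite_induct)
  case empty
  interpret R: vectorspace "class_ring :: real ring" "red_cohom L p"
    using red_cohom_rank(1)[OF L] by (simp add: fin_dim_space_def)
  have "(\<lambda>\<tau>\<in>simplices L p. 0) \<in> cocycles L p"
    using cocycles_subspace[OF L, of p] by (simp add: lin_subspace_def)
  then show ?case using cohom_class_zero[OF L, of p] by (simp only: sum.empty R.M.finsum_empty simp_thms)
next
  case (insert a A)
  interpret R: vectorspace "class_ring :: real ring" "red_cohom L p"
    using red_cohom_rank(1)[OF L] by (simp add: fin_dim_space_def)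
  have car: "cohom_class L p f \<in> carrier (red_cohom L p)" if "f \<in> cocycles L p" for f
    using cohom_class_linear(2)[OF L, of p] that by auto
  let ?s = "\<lambda>\<tau>\<in>simplices L p. \<Sum>i\<in>A. c i * g i \<tau>"
  let ?t = "\<lambda>\<tau>\<in>simplices L p. c a * g a \<tau>"
  have s: "?s \<in> cocycles L p" and eq: "(\<Oplus>\<^bsub>red_cohom L p\<^esub> i\<in>A. c i \<odot>\<^bsub>red_cohom L p\<^esub> cohom_class L p (g i)) = cohom_class L p ?s"
    using insert.IH[OF insert.prems[OF insertI2]] by (simp_all only: simp_thms)
  have ga: "g a \<in> cocycles L p" using insert by simp
  have t: "?t \<in> cocycles L p" by (rule cocycles_closed(2)[OF L ga ga])
  have "(\<lambda>\<tau>\<in>simplices L p. ?t \<tau> + ?s \<tau>) \<in> cocycles L p" by (rule cocycles_closed(1)[OF L t s])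
  moreover have st: "(\<lambda>\<tau>\<in>simplices L p. ?t \<tau> + ?s \<tau>) = (\<lambda>\<tau>\<in>simplices L p. \<Sum>i\<in>insert a A. c i * g i \<tau>)"
    using insert by (auto simp: restrict_def fun_eq_iff)
  moreover have "(\<Oplus>\<^bsub>red_cohom L p\<^esub> i\<in>insert a A. c i \<odot>\<^bsub>red_cohom L p\<^esub> cohom_class L p (g i))
      = c a \<odot>\<^bsub>red_cohom L p\<^esub> cohom_class L p (g a) \<oplus>\<^bsub>red_cohom L p\<^esub> cohom_class L p ?s"
    using insert car R.smult_closed by (subst R.M.finsum_insert) (auto simp: eq)
  moreover have "\<dots> = cohom_class L p (\<lambda>\<tau>\<in>simplices L p. ?t \<tau> + ?s \<tau>)"
    by (simp only: linear_on_cohom_class[OF L t s] linear_on_cohom_class[OF L ga ga])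
  ultimately show ?case by (simp only:)
qed

section \<open>The double complex of the full subcomplexes\<close>

lemma ext_pair: "(\<And>a b. f (a, b) = g (a, b)) \<Longrightarrow> f = g"
  by auto

definition cells :: "nat \<Rightarrow> nat set set \<Rightarrow> (nat set \<times> nat set) set" where
  "cells m K = {(I, \<tau>). I \<subseteq> {1..m} \<and> \<tau> \<in> K \<and> \<tau> \<subseteq> I}"

text \<open>
  A vertical cycle is a family of cocycles, one in each degree of each full subcomplex.
\<close>
definition vert :: "nat \<Rightarrow> nat set set \<Rightarrow> (nat set \<times> nat set \<Rightarrow> real) \<Rightarrow> (nat set \<times> nat set \<Rightarrow> real)" where
  "vert m K x = (\<lambda>(I, \<tau>). if (I, \<tau>) \<in> cells m K then \<Sum>v\<in>\<tau>. eps v \<tau> * x (I, \<tau> - {v}) else 0)"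

definition horiz :: "nat \<Rightarrow> nat set set \<Rightarrow> (nat set \<times> nat set \<Rightarrow> real) \<Rightarrow> (nat set \<times> nat set \<Rightarrow> real)" where
  "horiz m K x = (\<lambda>(J, \<tau>). if (J, \<tau>) \<in> cells m K
     then (-1) ^ card \<tau> * (\<Sum>i\<in>{1..m} - J. eps i (insert i J) * x (insert i J, \<tau>)) else 0)"

abbreviation total_cochains :: "nat \<Rightarrow> nat set set \<Rightarrow> (nat set \<times> nat set \<Rightarrow> real) set" where
  "total_cochains m K \<equiv> supported (cells m K)"

definition vert_cycles :: "nat \<Rightarrow> nat set set \<Rightarrow> (nat set \<times> nat set \<Rightarrow> real) set" where
  "vert_cycles m K = {x \<in> total_cochains m K. vert m K x = (\<lambda>c. 0)}"

definition vert_boundaries :: "nat \<Rightarrow> nat set set \<Rightarrow> (nat set \<times> nat set \<Rightarrow> real) set" where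
  "vert_boundaries m K = vert m K ` total_cochains m K"

text \<open>
  Modulo vertical boundaries this is the image of the differential of the double cohomology.
\<close>
definition mixed_boundaries :: "nat \<Rightarrow> nat set set \<Rightarrow> (nat set \<times> nat set \<Rightarrow> real) set" where
  "mixed_boundaries m K = {(\<lambda>c. x c + y c) | x y. x \<in> horiz m K ` vert_cycles m K \<and> y \<in> vert_boundaries m K}"

lemma simplicial_complexD:
  assumes "simplicial_complex m K"
  shows "finite K" "\<tau> \<in> K \<Longrightarrow> finite \<tau>" "\<tau> \<in> K \<Longrightarrow> \<rho> \<subseteq> \<tau> \<Longrightarrow> \<rho> \<in> K" "\<tau> \<in> K \<Longrightarrow> \<tau> \<subseteq> {1..m}"
proof -
  show "finite K" using assms finite_subset[of K "Pow {1..m}"] by (simp add: simplicial_complex_def)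
  show *: "\<tau> \<in> K \<Longrightarrow> \<tau> \<subseteq> {1..m}" using assms by (auto simp: simplicial_complex_def)
  show "\<tau> \<in> K \<Longrightarrow> finite \<tau>" using finite_subset[OF *] by simp
  show "\<tau> \<in> K \<Longrightarrow> \<rho> \<subseteq> \<tau> \<Longrightarrow> \<rho> \<in> K" using assms by (simp add: simplicial_complex_def)
qed

lemma full_subcomplex_finite: "simplicial_complex m K \<Longrightarrow> finite_complex (full_subcomplex K I)"
  unfolding finite_complex_def full_subcomplex_def
  by (auto dest: simplicial_complexD(1,2) simplicial_complexD(3))

lemma simplices_full: "\<tau> \<in> simplices (full_subcomplex K I) p \<longleftrightarrow> \<tau> \<in> K \<and> \<tau> \<subseteq> I \<and> int (card \<tau>) = p + 1"
  by (auto simp: simplices_def full_subcomplex_def)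

lemma cells_face:
  "simplicial_complex m K \<Longrightarrow> (I, \<tau>) \<in> cells m K \<Longrightarrow> (I, \<tau> - {v}) \<in> cells m K"
  using simplicial_complexD(3)[of m K \<tau> "\<tau> - {v}"] by (auto simp: cells_def)

lemma cells_insert: "(J, \<tau>) \<in> cells m K \<Longrightarrow> i \<in> {1..m} - J \<Longrightarrow> (insert i J, \<tau>) \<in> cells m K"
  by (auto simp: cells_def)

lemma cells_finite: "simplicial_complex m K \<Longrightarrow> finite (cells m K)"
  using simplicial_complexD(1)[of m K] by (intro finite_subset[of "cells m K" "Pow {1..m} \<times> K"]) (auto simp: cells_def)

lemma vert_linear: "pointwise_linear (vert m K)"
  by (auto simp: pointwise_linear_def vert_def fun_eq_iff distrib_left sum.distrib sum_distrib_left mult.left_commute)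

lemma horiz_linear: "pointwise_linear (horiz m K)"
  by (auto simp: pointwise_linear_def horiz_def fun_eq_iff distrib_left sum.distrib sum_distrib_left mult.left_commute)

lemma vert_total: "vert m K x \<in> total_cochains m K"
  by (auto simp: vert_def supported_def)

lemma horiz_total: "horiz m K x \<in> total_cochains m K"
  by (auto simp: horiz_def supported_def)

lemma vert_vert:
  assumes K: "simplicial_complex m K"
  shows "vert m K (vert m K x) = (\<lambda>c. 0)"
proof (rule ext_pair)
  fix I \<tau>
  show "vert m K (vert m K x) (I, \<tau>) = 0"
  proof (cases "(I, \<tau>) \<in> cells m K")
    case True
    then have "vert m K (vert m K x) (I, \<tau>) = (\<Sum>v\<in>\<tau>. eps v \<tau> * (\<Sum>w\<in>\<tau> - {v}. eps w (\<tau> - {v}) * x (I, \<tau> - {v} - {w})))"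
      using cells_face[OF K True] by (simp add: vert_def)
    also have "\<dots> = 0"
      using simplicial_complexD(2)[OF K] True
      by (intro coboundary_square_sum[of _ "\<lambda>\<rho>. x (I, \<rho>)"]) (auto simp: cells_def)
    finally show ?thesis .
  qed (simp add: vert_def)
qed

text \<open>
  The two orders in which \<open>i\<close> and \<open>k\<close> can be adjoined to \<open>J\<close> contribute with opposite signs.
\<close>
lemma horiz_horiz: "horiz m K (horiz m K x) = (\<lambda>c. 0)"
proof (rule ext_pair)
  fix J \<tau>
  show "horiz m K (horiz m K x) (J, \<tau>) = 0"
  proof (cases "(J, \<tau>) \<in> cells m K")
    case True
    let ?g = "\<lambda>i k. eps i (insert i J) * eps k (insert k (insert i J)) * x (insert k (insert i J), \<tau>)"
    have "(\<Sum>i\<in>{1..m} - J. \<Sum>k\<in>{1..m} - J - {i}. ?g i k) = 0"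
    proof (rule antisymmetric_sum_zero)
      fix i k assume ik: "i \<in> {1..m} - J" "k \<in> {1..m} - J" "i \<noteq> k"
      let ?L = "insert k (insert i J)"
      have L: "finite ?L" "k \<in> ?L" "i \<in> ?L" "k \<noteq> i" "?L - {k} = insert i J" "?L - {i} = insert k J" "insert i (insert k J) = ?L"
        using ik True finite_subset[of J "{1..m}"] by (auto simp: cells_def)
      from eps_swap[OF L(1-4)]
      show "?g i k = - ?g k i" unfolding L(5-7) by (simp add: mult.commute mult.left_commute)
    qed simp
    moreover have "{1..m} - J - {i} = {1..m} - insert i J" for i by auto
    ultimately have "(\<Sum>i\<in>{1..m} - J. eps i (insert i J) * (\<Sum>k\<in>{1..m} - insert i J. eps k (insert k (insert i J)) * x (insert k (insert i J), \<tau>))) = 0"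
      by (simp add: sum_distrib_left mult.assoc)
    then have *: "(\<Sum>i\<in>{1..m} - J. eps i (insert i J) * ((-1) ^ card \<tau> * (\<Sum>k\<in>{1..m} - insert i J. eps k (insert k (insert i J)) * x (insert k (insert i J), \<tau>)))) = 0"
      by (simp add: mult.left_commute[of _ "(-1) ^ card \<tau>"] sum_distrib_left[symmetric])
    have "horiz m K (horiz m K x) (J, \<tau>) = (-1) ^ card \<tau> * (\<Sum>i\<in>{1..m} - J. eps i (insert i J) * ((-1) ^ card \<tau> * (\<Sum>k\<in>{1..m} - insert i J. eps k (insert k (insert i J)) * x (insert k (insert i J), \<tau>))))"
      using True cells_insert[OF True] by (simp add: horiz_def)
    then show ?thesis unfolding * by simp
  qed (simp add: horiz_def)
qed

text \<open>
  The factor \<open>(-1)\<^sup>|\<^sup>\<tau>\<^sup>|\<close> of the horizontal differential, which is \<open>(-1)\<^sup>p\<^sup>+\<^sup>1\<close> in degree \<open>p\<close>, is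
  responsible for the minus sign, since the vertical differential changes \<open>|\<tau>|\<close> by one.
\<close>
lemma vert_horiz:
  assumes K: "simplicial_complex m K"
  shows "vert m K (horiz m K x) = (\<lambda>c. - horiz m K (vert m K x) c)"
proof (rule ext_pair)
  fix J \<tau>
  show "vert m K (horiz m K x) (J, \<tau>) = - horiz m K (vert m K x) (J, \<tau>)"
  proof (cases "(J, \<tau>) \<in> cells m K")
    case True
    have fin: "finite \<tau>" using True simplicial_complexD(2)[OF K] by (auto simp: cells_def)
    have sign: "(-1::real) ^ card (\<tau> - {v}) = - ((-1) ^ card \<tau>)" if "v \<in> \<tau>" for v
      using card_Suc_Diff1[OF fin that] by (metis power_Suc mult_minus1 minus_minus)
    have "vert m K (horiz m K x) (J, \<tau>)
        = (\<Sum>v\<in>\<tau>. eps v \<tau> * ((-1) ^ card (\<tau> - {v}) * (\<Sum>i\<in>{1..m} - J. eps i (insert i J) * x (insert i J, \<tau> - {v}))))"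
      using True cells_face[OF K True] by (simp add: vert_def horiz_def)
    also have "\<dots> = (\<Sum>v\<in>\<tau>. - ((-1) ^ card \<tau> * (\<Sum>i\<in>{1..m} - J. eps i (insert i J) * (eps v \<tau> * x (insert i J, \<tau> - {v})))))"
      by (intro sum.cong refl) (simp only: sign, simp add: sum_distrib_left sum_negf mult.left_commute)
    also have "\<dots> = - ((-1) ^ card \<tau> * (\<Sum>i\<in>{1..m} - J. \<Sum>v\<in>\<tau>. eps i (insert i J) * (eps v \<tau> * x (insert i J, \<tau> - {v}))))"
      by (simp add: sum_negf sum_distrib_left[symmetric]) (subst sum.swap, simp add: sum_distrib_left)
    also have "\<dots> = - horiz m K (vert m K x) (J, \<tau>)"
      using True cells_insert[OF True] by (simp add: vert_def horiz_def sum_distrib_left)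
    finally show ?thesis .
  qed (simp add: horiz_def vert_def)
qed

lemma vert_boundaries_subset: "simplicial_complex m K \<Longrightarrow> vert_boundaries m K \<subseteq> vert_cycles m K"
  by (auto simp: vert_boundaries_def vert_cycles_def vert_total vert_vert)

lemma horiz_vert_cycles: "simplicial_complex m K \<Longrightarrow> x \<in> vert_cycles m K \<Longrightarrow> horiz m K x \<in> vert_cycles m K"
  by (auto simp: vert_cycles_def horiz_total vert_horiz pointwise_linearD(3)[OF horiz_linear])

lemma vert_cycles_subspace: "fun_subspace (vert_cycles m K)"
  unfolding vert_cycles_def by (rule fun_subspace_kernel[OF vert_linear fun_subspace_supported])

lemma vert_boundaries_subspace: "fun_subspace (vert_boundaries m K)"
  unfolding vert_boundaries_def by (rule fun_subspace_image[OF vert_linear fun_subspace_supported])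

lemma mixed_boundaries_subspace: "fun_subspace (mixed_boundaries m K)"
  unfolding mixed_boundaries_def
  by (intro fun_subspace_sum fun_subspace_image[OF horiz_linear] vert_cycles_subspace vert_boundaries_subspace)

lemma mixed_boundaries_vert_cycles:
  assumes "simplicial_complex m K" shows "mixed_boundaries m K \<subseteq> vert_cycles m K"
proof -
  have "(\<lambda>c. x c + y c) \<in> vert_cycles m K" if "x \<in> vert_cycles m K" "y \<in> vert_cycles m K" for x y
    using vert_cycles_subspace that by (auto simp: fun_subspace_def)
  then show ?thesis
    using horiz_vert_cycles[OF assms] vert_boundaries_subset[OF assms] by (auto simp: mixed_boundaries_def)
qed

lemma vert_boundaries_mixed_boundaries: "vert_boundaries m K \<subseteq> mixed_boundaries m K"
proof
  fix y assume y: "y \<in> vert_boundaries m K"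
  have "(\<lambda>c. 0) \<in> horiz m K ` vert_cycles m K"
    using fun_subspace_image[OF horiz_linear vert_cycles_subspace] by (auto simp: fun_subspace_def)
  then show "y \<in> mixed_boundaries m K" using y unfolding mixed_boundaries_def by force
qed

lemma total_fin_dim_space: "simplicial_complex m K \<Longrightarrow> fin_dim_space (fun_space (total_cochains m K))"
  by (rule supported_fin_dim_space[OF cells_finite])

lemma vert_cycles_fin_dim_space: "simplicial_complex m K \<Longrightarrow> fin_dim_space (fun_space (vert_cycles m K))"
  by (rule fun_subspace_fin_dim_space[OF total_fin_dim_space _ vert_cycles_subspace]) (auto simp: vert_cycles_def)

section \<open>Double cohomology from the double complex\<close>

definition slice :: "nat set set \<Rightarrow> (nat set \<times> nat set \<Rightarrow> real) \<Rightarrow> nat set \<Rightarrow> int \<Rightarrow> nat set \<Rightarrow> real" where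
  "slice K x I p = (\<lambda>\<tau>\<in>simplices (full_subcomplex K I) p. x (I, \<tau>))"

text \<open>
  The vertical cohomology class of a function, read as an element of the direct sum of all the
  groups \<open>H\<^sup>p(K\<^sub>I)\<close>.
\<close>
definition total_class :: "nat \<Rightarrow> nat set set \<Rightarrow> (nat set \<times> nat set \<Rightarrow> real) \<Rightarrow> (nat set \<times> int \<Rightarrow> (nat set \<Rightarrow> real) set)" where
  "total_class m K x = (\<lambda>(I, p)\<in>Pow {1..m} \<times> UNIV. cohom_class (full_subcomplex K I) p (slice K x I p))"

lemma slice_cocycle:
  assumes K: "simplicial_complex m K" and x: "x \<in> vert_cycles m K" and I: "I \<subseteq> {1..m}"
  shows "slice K x I p \<in> cocycles (full_subcomplex K I) p"
proof -
  have "(\<Sum>v\<in>\<tau>. eps v \<tau> * slice K x I p (\<tau> - {v})) = 0" if \<tau>: "\<tau> \<in> simplices (full_subcomplex K I) (p + 1)" for \<tau>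
  proof -
    have "(\<Sum>v\<in>\<tau>. eps v \<tau> * slice K x I p (\<tau> - {v})) = (\<Sum>v\<in>\<tau>. eps v \<tau> * x (I, \<tau> - {v}))"
      using simplices_face[OF full_subcomplex_finite[OF K] \<tau>] by (intro sum.cong) (auto simp: slice_def)
    also have "\<dots> = vert m K x (I, \<tau>)"
      using \<tau> I by (auto simp: vert_def cells_def simplices_full)
    finally show ?thesis using x by (simp add: vert_cycles_def)
  qed
  then show ?thesis by (simp add: cocycles_iff slice_def)
qed

lemma H_Z_carrier:
  "y \<in> carrier (H_Z m K) \<longleftrightarrow> y \<in> extensional (Pow {1..m} \<times> UNIV) \<and>
     (\<forall>I p. I \<subseteq> {1..m} \<longrightarrow> y (I, p) \<in> carrier (red_cohom (full_subcomplex K I) p)) \<and>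
     finite {c \<in> Pow {1..m} \<times> UNIV. y c \<noteq> zero (red_cohom (full_subcomplex K (fst c)) (snd c))}"
  by (auto simp: H_Z_def module_dsum_def case_prod_unfold PiE_def Pi_def)

lemma H_Z_simps:
  "zero (H_Z m K) = (\<lambda>(I, p)\<in>Pow {1..m} \<times> UNIV. zero (red_cohom (full_subcomplex K I) p))"
  "add (H_Z m K) = (\<lambda>x y. \<lambda>(I, p)\<in>Pow {1..m} \<times> UNIV. x (I, p) \<oplus>\<^bsub>red_cohom (full_subcomplex K I) p\<^esub> y (I, p))"
  "smult (H_Z m K) = (\<lambda>r x. \<lambda>(I, p)\<in>Pow {1..m} \<times> UNIV. r \<odot>\<^bsub>red_cohom (full_subcomplex K I) p\<^esub> x (I, p))"
  by (simp_all add: H_Z_def module_dsum_def case_prod_unfold)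

lemma total_class_apply: "I \<subseteq> {1..m} \<Longrightarrow> total_class m K x (I, p) = cohom_class (full_subcomplex K I) p (slice K x I p)"
  by (simp add: total_class_def)

lemma total_class_linear:
  assumes K: "simplicial_complex m K"
  shows "linear_on (fun_space (vert_cycles m K)) (H_Z m K) (total_class m K)"
  unfolding linear_on_def
proof (intro conjI ballI allI)
  note fin = full_subcomplex_finite[OF K]
  fix x y assume xy: "x \<in> carrier (fun_space (vert_cycles m K))" "y \<in> carrier (fun_space (vert_cycles m K))"
  have sl: "slice K x I p \<in> cocycles (full_subcomplex K I) p" "slice K y I p \<in> cocycles (full_subcomplex K I) p"
    if "I \<subseteq> {1..m}" for I p
    using xy that slice_cocycle[OF K] by simp_all
  have a: "slice K (\<lambda>c. x c + y c) I p = (\<lambda>\<tau>\<in>simplices (full_subcomplex K I) p. slice K x I p \<tau> + slice K y I p \<tau>)" for I p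
    by (auto simp: slice_def restrict_def fun_eq_iff)
  have "total_class m K (\<lambda>c. x c + y c) = total_class m K x \<oplus>\<^bsub>H_Z m K\<^esub> total_class m K y"
  proof (rule ext_pair)
    fix I p
    show "total_class m K (\<lambda>c. x c + y c) (I, p) = (total_class m K x \<oplus>\<^bsub>H_Z m K\<^esub> total_class m K y) (I, p)"
      using linear_on_cohom_class(1)[OF fin sl] by (cases "I \<subseteq> {1..m}") (simp_all add: total_class_def H_Z_simps a)
  qed
  then show "total_class m K (x \<oplus>\<^bsub>fun_space (vert_cycles m K)\<^esub> y) = total_class m K x \<oplus>\<^bsub>H_Z m K\<^esub> total_class m K y" by simp
next
  note fin = full_subcomplex_finite[OF K]
  fix r x assume x: "x \<in> carrier (fun_space (vert_cycles m K))"
  have sl: "slice K x I p \<in> cocycles (full_subcomplex K I) p" if "I \<subseteq> {1..m}" for I p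
    using x that slice_cocycle[OF K] by simp
  have a: "slice K (\<lambda>c. r * x c) I p = (\<lambda>\<tau>\<in>simplices (full_subcomplex K I) p. r * slice K x I p \<tau>)" for I p
    by (auto simp: slice_def restrict_def fun_eq_iff)
  have "total_class m K (\<lambda>c. r * x c) = r \<odot>\<^bsub>H_Z m K\<^esub> total_class m K x"
  proof (rule ext_pair)
    fix I p
    show "total_class m K (\<lambda>c. r * x c) (I, p) = (r \<odot>\<^bsub>H_Z m K\<^esub> total_class m K x) (I, p)"
      using linear_on_cohom_class(2)[OF fin sl sl] by (cases "I \<subseteq> {1..m}") (simp_all add: total_class_def H_Z_simps a)
  qed
  then show "total_class m K (r \<odot>\<^bsub>fun_space (vert_cycles m K)\<^esub> x) = r \<odot>\<^bsub>H_Z m K\<^esub> total_class m K x" by simp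
next
  have "slice K (\<lambda>c. 0) I p = (\<lambda>\<tau>\<in>simplices (full_subcomplex K I) p. 0)" for I p
    by (simp add: slice_def)
  then show "total_class m K \<zero>\<^bsub>fun_space (vert_cycles m K)\<^esub> = \<zero>\<^bsub>H_Z m K\<^esub>"
    using cohom_class_zero[OF full_subcomplex_finite[OF K]] by (simp add: total_class_def H_Z_simps)
qed

text \<open>
  Representatives can be chosen independently for all \<open>(I, p)\<close> and glued, because \<open>\<tau>\<close> determines
  \<open>p\<close>.  Only finitely many degrees matter, as there are no simplices outside \<open>-1 \<le> p < m\<close>.
\<close>
lemma total_class_onto:
  assumes K: "simplicial_complex m K"
  shows "total_class m K ` vert_cycles m K = carrier (H_Z m K)"
proof (intro subset_antisym subsetI)
  note fin = full_subcomplex_finite[OF K]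
  fix y assume "y \<in> total_class m K ` vert_cycles m K"
  then obtain x where x: "x \<in> vert_cycles m K" "y = total_class m K x" by blast
  have bound: "p \<in> {-1..int m}" if I: "I \<subseteq> {1..m}" and ne: "y (I, p) \<noteq> zero (red_cohom (full_subcomplex K I) p)" for I p
    proof (rule ccontr)
      assume p: "p \<notin> {-1..int m}"
      have "card \<tau> \<le> m" if "\<tau> \<in> K" for \<tau>
        using card_mono[OF _ simplicial_complexD(4)[OF K that]] by simp
      then have "simplices (full_subcomplex K I) p = {}"
        using p by (auto simp: simplices_full) force
      then have "slice K x I p = (\<lambda>\<tau>\<in>simplices (full_subcomplex K I) p. 0)" by (auto simp: slice_def)
      then show False using ne cohom_class_zero[OF fin, of I p] I by (simp add: x(2) total_class_apply)
    qed
  have "{c \<in> Pow {1..m} \<times> UNIV. y c \<noteq> zero (red_cohom (full_subcomplex K (fst c)) (snd c))} \<subseteq> Pow {1..m} \<times> {-1..int m}"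
    using bound by (intro subsetI) (simp only: mem_Collect_eq mem_Times_iff Pow_iff, metis prod.collapse)
  then have "finite {c \<in> Pow {1..m} \<times> UNIV. y c \<noteq> zero (red_cohom (full_subcomplex K (fst c)) (snd c))}"
    by (rule finite_subset) simp
  moreover have "y (I, p) \<in> carrier (red_cohom (full_subcomplex K I) p)" if "I \<subseteq> {1..m}" for I p
    using cohom_class_linear(2)[OF fin, of I p] slice_cocycle[OF K x(1) that, of p] that by (auto simp: x(2) total_class_apply)
  moreover have "y \<in> extensional (Pow {1..m} \<times> UNIV)" by (simp add: x(2) total_class_def)
  ultimately show "y \<in> carrier (H_Z m K)" by (simp only: H_Z_carrier) blast
next
  note fin = full_subcomplex_finite[OF K]
  fix y assume y: "y \<in> carrier (H_Z m K)"
  have "\<exists>f. f \<in> cocycles (full_subcomplex K I) p \<and> y (I, p) = cohom_class (full_subcomplex K I) p f" if "I \<subseteq> {1..m}" for I p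
  proof -
    have "y (I, p) \<in> carrier (red_cohom (full_subcomplex K I) p)" using y that by (simp only: H_Z_carrier)
    then show ?thesis unfolding cohom_class_linear(2)[OF fin, symmetric] by blast
  qed
  then obtain f where f: "\<And>I p. I \<subseteq> {1..m} \<Longrightarrow> f I p \<in> cocycles (full_subcomplex K I) p \<and> y (I, p) = cohom_class (full_subcomplex K I) p (f I p)"
    by metis
  define x where "x = (\<lambda>(I, \<tau>). if (I, \<tau>) \<in> cells m K then f I (int (card \<tau>) - 1) \<tau> else 0)"
  have sl: "slice K x I p = f I p" if I: "I \<subseteq> {1..m}" for I p
  proof -
    have "f I p \<in> extensional (simplices (full_subcomplex K I) p)"
      using f[OF I, of p] by (auto simp: cocycles_iff PiE_def)
    moreover have "slice K x I p \<tau> = f I p \<tau>" if "\<tau> \<in> simplices (full_subcomplex K I) p" for \<tau>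
      using that I by (simp add: slice_def x_def) (auto simp: simplices_full cells_def)
    ultimately show ?thesis by (intro extensionalityI[of _ "simplices (full_subcomplex K I) p"]) (auto simp: slice_def)
  qed
  have "vert m K x (I, \<tau>) = 0" for I \<tau>
  proof (cases "(I, \<tau>) \<in> cells m K")
    case True
    define p where "p = int (card \<tau>) - 2"
    have I: "I \<subseteq> {1..m}" and \<tau>: "\<tau> \<in> simplices (full_subcomplex K I) (p + 1)"
      using True by (auto simp: cells_def simplices_full p_def)
    have "vert m K x (I, \<tau>) = (\<Sum>v\<in>\<tau>. eps v \<tau> * x (I, \<tau> - {v}))" using True by (simp add: vert_def)
    also have "\<dots> = (\<Sum>v\<in>\<tau>. eps v \<tau> * slice K x I p (\<tau> - {v}))"
      using simplices_face[OF fin \<tau>] by (intro sum.cong) (auto simp: slice_def)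
    also have "\<dots> = 0" using f[OF I, of p] \<tau> by (auto simp: sl[OF I] cocycles_iff)
    finally show ?thesis .
  qed (simp add: vert_def)
  then have "x \<in> vert_cycles m K" by (auto simp: vert_cycles_def supported_def x_def)
  moreover have "total_class m K x = y"
  proof (rule ext_pair)
    fix I p
    show "total_class m K x (I, p) = y (I, p)"
      using y f[of I p] by (cases "I \<subseteq> {1..m}") (auto simp: total_class_def sl H_Z_carrier extensional_def)
  qed
  ultimately show "y \<in> total_class m K ` vert_cycles m K" by blast
qed

text \<open>
  Primitives in the individual cochain groups glue to a primitive in the double complex.
\<close>
lemma total_class_kernel:
  assumes K: "simplicial_complex m K" and x: "x \<in> vert_cycles m K"
  shows "total_class m K x = zero (H_Z m K) \<longleftrightarrow> x \<in> vert_boundaries m K"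
proof
  note fin = full_subcomplex_finite[OF K]
  assume *: "total_class m K x = zero (H_Z m K)"
  have "\<exists>h. slice K x I p = coboundary (full_subcomplex K I) (p - 1) h" if I: "I \<subseteq> {1..m}" for I p
  proof -
    have "cohom_class (full_subcomplex K I) p (slice K x I p) = coboundaries (full_subcomplex K I) p"
      using fun_cong[OF *, of "(I, p)"] I by (simp add: total_class_def H_Z_simps)
    then have "slice K x I p \<in> coboundaries (full_subcomplex K I) p"
      using cohom_class_linear(3)[OF fin slice_cocycle[OF K x I]] by simp
    then show ?thesis by (auto simp: coboundaries_def)
  qed
  then obtain h where h: "\<And>I p. I \<subseteq> {1..m} \<Longrightarrow> slice K x I p = coboundary (full_subcomplex K I) (p - 1) (h I p)"
    by metis
  define y where "y = (\<lambda>(I, \<tau>). if (I, \<tau>) \<in> cells m K then h I (int (card \<tau>)) \<tau> else 0)"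
  have "vert m K y (I, \<tau>) = x (I, \<tau>)" for I \<tau>
  proof (cases "(I, \<tau>) \<in> cells m K")
    case True
    define p where "p = int (card \<tau>) - 1"
    have I: "I \<subseteq> {1..m}" and \<tau>: "\<tau> \<in> simplices (full_subcomplex K I) p" and fin\<tau>: "finite \<tau>"
      using True simplicial_complexD(2)[OF K] by (auto simp: cells_def simplices_full p_def)
    have "y (I, \<tau> - {v}) = h I p (\<tau> - {v})" if v: "v \<in> \<tau>" for v
    proof -
      have "int (card (\<tau> - {v})) = p" using card_Suc_Diff1[OF fin\<tau> v] by (simp add: p_def)
      then show ?thesis using cells_face[OF K True] by (simp add: y_def)
    qed
    then have "vert m K y (I, \<tau>) = coboundary (full_subcomplex K I) (p - 1) (h I p) \<tau>"
      using True \<tau> by (simp add: vert_def coboundary_def)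
    also have "\<dots> = x (I, \<tau>)" using \<tau> by (simp add: h[OF I, symmetric] slice_def)
    finally show ?thesis .
  next
    case False
    then show ?thesis using x by (simp add: vert_def vert_cycles_def supported_def)
  qed
  then have "vert m K y = x" by auto
  moreover have "y \<in> total_cochains m K" by (auto simp: y_def supported_def)
  ultimately show "x \<in> vert_boundaries m K" unfolding vert_boundaries_def by blast
next
  note fin = full_subcomplex_finite[OF K]
  assume "x \<in> vert_boundaries m K"
  then obtain y where y: "x = vert m K y" by (auto simp: vert_boundaries_def)
  have "cohom_class (full_subcomplex K I) p (slice K x I p) = coboundaries (full_subcomplex K I) p" if I: "I \<subseteq> {1..m}" for I p
  proof -
    have "slice K x I p = coboundary (full_subcomplex K I) (p - 1) (slice K y I (p - 1))"
    proof
      fix \<tau>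
      show "slice K x I p \<tau> = coboundary (full_subcomplex K I) (p - 1) (slice K y I (p - 1)) \<tau>"
        using simplices_face[OF fin, of \<tau> I "p - 1"] I
        by (auto simp: slice_def y coboundary_def vert_def simplices_full cells_def intro!: sum.cong)
    qed
    then have "slice K x I p \<in> coboundaries (full_subcomplex K I) p"
      by (auto simp: coboundaries_def slice_def)
    then show ?thesis using cohom_class_linear(3)[OF fin slice_cocycle[OF K x I]] by simp
  qed
  then show "total_class m K x = zero (H_Z m K)" by (auto simp: total_class_def H_Z_simps fun_eq_iff)
qed

text \<open>
  Both sides are computed on representatives: \<open>psi\<close> restricts them, and a finite sum of classes is the
  class of the sum.
\<close>
lemma total_class_horiz:
  assumes K: "simplicial_complex m K" and x: "x \<in> vert_cycles m K"
  shows "total_class m K (horiz m K x) = d' m K (total_class m K x)"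
proof (rule ext_pair)
  note fin = full_subcomplex_finite[OF K]
  fix J p
  show "total_class m K (horiz m K x) (J, p) = d' m K (total_class m K x) (J, p)"
  proof (cases "J \<subseteq> {1..m}")
    case J: True
    let ?L = "full_subcomplex K J"
    let ?g = "\<lambda>i. restrict (slice K x (insert i J) p) (simplices ?L p)"
    let ?c = "\<lambda>i. (-1) powi (p + 1) * eps i (insert i J)"
    have sub: "?L \<subseteq> full_subcomplex K (insert i J)" for i by (auto simp: full_subcomplex_def)
    have g: "?g i \<in> cocycles ?L p" if "i \<in> {1..m} - J" for i
      using slice_cocycle[OF K x, of "insert i J"] that J by (intro restrict_cocycle[OF fin sub]) auto
    have psi: "psi K p i (insert i J) (total_class m K x (insert i J, p)) = cohom_class ?L p (?g i)" if i: "i \<in> {1..m} - J" for i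
    proof -
      have "insert i J \<subseteq> {1..m}" "insert i J - {i} = J" using i J by auto
      then show ?thesis
        using restr_cohom_cohom_class[OF fin fin sub, OF slice_cocycle[OF K x]] by (simp add: psi_def total_class_apply)
    qed
    have "d' m K (total_class m K x) (J, p) = (\<Oplus>\<^bsub>red_cohom ?L p\<^esub> i\<in>{1..m} - J. ?c i \<odot>\<^bsub>red_cohom ?L p\<^esub> psi K p i (insert i J) (total_class m K x (insert i J, p)))"
      using J by (simp add: d'_def)
    also have "\<dots> = (\<Oplus>\<^bsub>red_cohom ?L p\<^esub> i\<in>{1..m} - J. ?c i \<odot>\<^bsub>red_cohom ?L p\<^esub> cohom_class ?L p (?g i))"
    proof -
      interpret R: vectorspace "class_ring :: real ring" "red_cohom ?L p"
        using red_cohom_rank(1)[OF fin] by (simp add: fin_dim_space_def)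
      have "cohom_class ?L p (?g i) \<in> carrier (red_cohom ?L p)" if "i \<in> {1..m} - J" for i
        using cohom_class_linear(2)[OF fin, of J p] g[OF that] by blast
      then show ?thesis by (intro R.M.finsum_cong') (auto simp: psi R.smult_closed)
    qed
    also have "\<dots> = cohom_class ?L p (\<lambda>\<tau>\<in>simplices ?L p. \<Sum>i\<in>{1..m} - J. ?c i * ?g i \<tau>)"
      by (rule conjunct2[OF finsum_cohom_class[OF fin _ g]]) simp_all
    also have "(\<lambda>\<tau>\<in>simplices ?L p. \<Sum>i\<in>{1..m} - J. ?c i * ?g i \<tau>) = slice K (horiz m K x) J p"
      unfolding slice_def[of K "horiz m K x"]
    proof (rule restrict_ext)
      fix \<tau> assume \<tau>: "\<tau> \<in> simplices ?L p"
      then have "(J, \<tau>) \<in> cells m K" and p: "p + 1 = int (card \<tau>)" using J by (auto simp: simplices_full cells_def)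
      moreover have "?g i \<tau> = x (insert i J, \<tau>)" for i using \<tau> by (auto simp: slice_def simplices_full)
      ultimately show "(\<Sum>i\<in>{1..m} - J. ?c i * ?g i \<tau>) = horiz m K x (J, \<tau>)"
        unfolding p by (simp add: horiz_def sum_distrib_left mult.assoc)
    qed
    finally show ?thesis using J by (simp add: total_class_apply)
  qed (simp add: total_class_def d'_def)
qed

text \<open>
  The surjection from vertical cycles to \<open>H_Z\<close> transports \<open>d'\<close> to the horizontal differential.  With
  \<open>z\<close>, \<open>b\<close> and \<open>q\<close> the ranks of vertical cycles, vertical boundaries and mixed boundaries, the rank of
  \<open>HH\<close> is \<open>(z - b) - 2 (q - b) = z + b - 2 q\<close>, and \<open>z + b\<close> is the rank of the whole double complex.
\<close>
theorem rank_HH: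
  assumes K: "simplicial_complex m K"
  shows "rank (HH m K) + 2 * fun_rank (mixed_boundaries m K) = fun_rank (total_cochains m K)"
proof -
  note Z = vert_cycles_fin_dim_space[OF K]
  have B_fd: "fin_dim_space (fun_space (mixed_boundaries m K))"
    by (rule fun_subspace_fin_dim_space[OF Z mixed_boundaries_vert_cycles[OF K] mixed_boundaries_subspace])
  have H: "fin_dim_space (H_Z m K)"
    and rank_H: "fun_rank (vert_cycles m K) = rank (H_Z m K) + fun_rank {x \<in> vert_cycles m K. total_class m K x = zero (H_Z m K)}"
    using rank_nullity_onto[OF Z total_class_linear[OF K]] total_class_onto[OF K] by simp_all
  have "{x \<in> vert_cycles m K. total_class m K x = zero (H_Z m K)} = vert_boundaries m K"
    using total_class_kernel[OF K] vert_boundaries_subset[OF K] by blast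
  with rank_H have rank_H: "fun_rank (vert_cycles m K) = rank (H_Z m K) + fun_rank (vert_boundaries m K)" by simp
  have total_cochains: "fun_rank (total_cochains m K) = fun_rank (vert_boundaries m K) + fun_rank (vert_cycles m K)"
    using fun_rank_nullity[OF total_fin_dim_space[OF K] vert_linear] by (simp add: vert_boundaries_def vert_cycles_def)
  have t: "total_class m K (\<lambda>c. x c + y c) = total_class m K x \<oplus>\<^bsub>H_Z m K\<^esub> total_class m K y"
    "total_class m K (\<lambda>c. r * x c) = r \<odot>\<^bsub>H_Z m K\<^esub> total_class m K x"
    if "x \<in> vert_cycles m K" "y \<in> vert_cycles m K" for x y r
    using total_class_linear[OF K] that by (simp_all add: linear_on_def)
  have t0: "total_class m K (\<lambda>c. 0) = zero (H_Z m K)" using total_class_linear[OF K] by (simp add: linear_on_def)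
  have lin: "(\<lambda>c. 0) \<in> vert_cycles m K" "\<And>x y. x \<in> vert_cycles m K \<Longrightarrow> y \<in> vert_cycles m K \<Longrightarrow> (\<lambda>c. x c + y c) \<in> vert_cycles m K"
    "\<And>r x. x \<in> vert_cycles m K \<Longrightarrow> (\<lambda>c. r * x c) \<in> vert_cycles m K"
    using vert_cycles_subspace by (auto simp: fun_subspace_def)
  note h = pointwise_linearD[OF horiz_linear]
  note hz = horiz_vert_cycles[OF K]
  note d = total_class_horiz[OF K, symmetric]
  have d_lin: "linear_on (H_Z m K) (H_Z m K) (d' m K)"
    unfolding linear_on_def total_class_onto[OF K, symmetric] t0[symmetric]
    by (simp add: t[symmetric] d h hz lin)
  have d_im: "d' m K ` carrier (H_Z m K) = total_class m K ` horiz m K ` vert_cycles m K"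
    unfolding total_class_onto[OF K, symmetric] by (auto simp: d image_image)
  have d_sub: "d' m K ` carrier (H_Z m K) \<subseteq> carrier (H_Z m K)"
    unfolding total_class_onto[OF K, symmetric] by (auto simp: d hz)
  have d_d: "d' m K (d' m K y) = zero (H_Z m K)" if "y \<in> carrier (H_Z m K)" for y
    using that unfolding total_class_onto[OF K, symmetric] by (auto simp: d hz horiz_horiz t0)
  have HH: "rank (HH m K) + 2 * rank (vsub (H_Z m K) (d' m K ` carrier (H_Z m K))) = rank (H_Z m K)"
    using rank_homology[OF H d_lin d_sub d_d] by (simp add: HH_def)
  have im: "total_class m K ` mixed_boundaries m K = d' m K ` carrier (H_Z m K)"
  proof -
    interpret H: vectorspace "class_ring :: real ring" "H_Z m K" using H by (simp add: fin_dim_space_def)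
    have "total_class m K (\<lambda>c. x c + y c) = total_class m K x" if x: "x \<in> vert_cycles m K" and y: "y \<in> vert_boundaries m K" for x y
    proof -
      have "y \<in> vert_cycles m K" using y vert_boundaries_subset[OF K] by blast
      moreover from this have "total_class m K y = zero (H_Z m K)" using total_class_kernel[OF K] y by simp
      moreover have "total_class m K x \<in> carrier (H_Z m K)" using total_class_onto[OF K] x by blast
      ultimately show ?thesis using t(1)[OF x] by simp
    qed
    note * = this
    have "(\<lambda>c. 0) \<in> vert_boundaries m K" using vert_boundaries_subspace by (auto simp: fun_subspace_def)
    then have "z \<in> mixed_boundaries m K" if "z \<in> horiz m K ` vert_cycles m K" for z
      using that unfolding mixed_boundaries_def by force
    then show ?thesis unfolding d_im using * hz by (fastforce simp: mixed_boundaries_def)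
  qed
  have "linear_on (fun_space (mixed_boundaries m K)) (vsub (H_Z m K) (d' m K ` carrier (H_Z m K))) (total_class m K)"
    using total_class_linear[OF K] mixed_boundaries_vert_cycles[OF K] by (simp add: linear_on_def subset_iff)
  from rank_nullity_onto(2)[OF B_fd this]
  have "fun_rank (mixed_boundaries m K) = rank (vsub (H_Z m K) (d' m K ` carrier (H_Z m K)))
      + fun_rank {x \<in> mixed_boundaries m K. total_class m K x = zero (H_Z m K)}" by (simp add: im)
  moreover have "{x \<in> mixed_boundaries m K. total_class m K x = zero (H_Z m K)} = vert_boundaries m K"
    using total_class_kernel[OF K] mixed_boundaries_vert_cycles[OF K] vert_boundaries_mixed_boundaries[of m K] by blast
  ultimately show ?thesis using HH rank_H total_cochains by simp
qed

section \<open>Attaching a simplex\<close>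

definition facet_sum :: "(nat set \<times> nat set \<Rightarrow> real) \<Rightarrow> nat set \<Rightarrow> nat set \<Rightarrow> real" where
  "facet_sum x I \<tau> = (\<Sum>v\<in>\<tau>. eps v \<tau> * x (I, \<tau> - {v}))"

text \<open>
  The boundary of a simplex is a cycle.  It is used with a whole simplex \<open>\<tau>\<close> that need not belong to
  the complex: then it relates the values of a cochain on the boundaries of the facets of \<open>\<tau>\<close>.
\<close>
lemma facet_sum_facet_sum:
  "finite \<tau> \<Longrightarrow> (\<Sum>v\<in>\<tau>. eps v \<tau> * facet_sum x I (\<tau> - {v})) = 0"
  unfolding facet_sum_def by (rule coboundary_square_sum[of \<tau> "\<lambda>\<rho>. x (I, \<rho>)"])

lemma vert_facet_sum: "(I, \<tau>) \<in> cells m K \<Longrightarrow> vert m K x (I, \<tau>) = facet_sum x I \<tau>"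
  by (simp add: vert_def facet_sum_def)

lemma sign_exchange:
  fixes a b c e :: real
  assumes "a * c = - (b * e)" "b * b = 1" "c * c = 1"
  shows "a * b = - (c * e)"
proof -
  have "a * b = (a * c) * (c * b)" using assms(3) by (simp add: mult.assoc mult.left_commute)
  also have "\<dots> = - ((b * b) * (c * e))" unfolding assms(1) by simp
  finally show ?thesis using assms(2) by simp
qed

text \<open>
  The homotopy operator that contracts a cone with apex \<open>a\<close>.
\<close>
definition cone :: "nat \<Rightarrow> (nat set \<Rightarrow> real) \<Rightarrow> nat set \<Rightarrow> real" where
  "cone a f \<tau> = (if a \<in> \<tau> then 0 else eps a (insert a \<tau>) * f (insert a \<tau>))"

text \<open>
  Only the cocycle equation of \<open>f\<close> at \<open>insert a \<tau>\<close> enters, so the equation can be applied one simplex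
  at a time, with an apex that depends on the full subcomplex under consideration.
\<close>
lemma cone_contraction:
  assumes fin: "finite \<tau>" 
    and cyc: "a \<notin> \<tau> \<Longrightarrow> (\<Sum>v\<in>insert a \<tau>. eps v (insert a \<tau>) * f (insert a \<tau> - {v})) = 0"
  shows "(\<Sum>v\<in>\<tau>. eps v \<tau> * cone a f (\<tau> - {v})) = f \<tau>"
proof (cases "a \<in> \<tau>")
  case True
  have "(\<Sum>v\<in>\<tau>. eps v \<tau> * cone a f (\<tau> - {v})) = (\<Sum>v\<in>\<tau>. if v = a then f \<tau> else 0)"
    using True by (intro sum.cong) (auto simp: cone_def insert_absorb mult.assoc[symmetric])
  then show ?thesis using True fin by simp
next
  case False
  let ?r = "insert a \<tau>"
  have s: "eps v \<tau> * eps a (?r - {v}) = - (eps a ?r * eps v ?r)" if "v \<in> \<tau>" for v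
  proof -
    have "eps a ?r * eps v \<tau> = - (eps v ?r * eps a (?r - {v}))"
      using eps_swap[of ?r a v] fin that False by auto
    then have "eps v \<tau> * eps a ?r = - (eps a (?r - {v}) * eps v ?r)" by (simp only: mult.commute)
    then have "eps v \<tau> * eps a (?r - {v}) = - (eps a ?r * eps v ?r)"
      by (rule sign_exchange) simp_all
    then show ?thesis .
  qed
  have "(\<Sum>v\<in>\<tau>. eps v \<tau> * cone a f (\<tau> - {v})) = (\<Sum>v\<in>\<tau>. - (eps a ?r * (eps v ?r * f (?r - {v}))))"
  proof (rule sum.cong[OF refl])
    fix v assume v: "v \<in> \<tau>"
    then have "insert a (\<tau> - {v}) = ?r - {v}" using False by auto
    then have "eps v \<tau> * cone a f (\<tau> - {v}) = eps v \<tau> * eps a (?r - {v}) * f (?r - {v})"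
      using False by (simp add: cone_def)
    then show "eps v \<tau> * cone a f (\<tau> - {v}) = - (eps a ?r * (eps v ?r * f (?r - {v})))"
      by (simp add: s[OF v])
  qed
  also have "\<dots> = eps a ?r * - (\<Sum>v\<in>\<tau>. eps v ?r * f (?r - {v}))"
    by (simp add: sum_negf sum_distrib_left)
  also have "- (\<Sum>v\<in>\<tau>. eps v ?r * f (?r - {v})) = eps a ?r * f \<tau>"
    using cyc[OF False] fin False by simp
  finally show ?thesis by (simp add: mult.assoc[symmetric])
qed

definition ind :: "'a \<Rightarrow> 'a \<Rightarrow> real" where "ind c = (\<lambda>x. if x = c then 1 else 0)"

text \<open>
  The coboundary of an indicator function is a signed sum of indicators, one for each coface.
\<close>
lemma vert_ind:
  assumes K: "simplicial_complex m K"
    and W: "W = {w. w \<notin> \<tau>0 \<and> (I0, insert w \<tau>0) \<in> cells m K}"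
  shows "vert m K (ind (I0, \<tau>0)) = (\<lambda>c. \<Sum>w\<in>W. eps w (insert w \<tau>0) * ind (I0, insert w \<tau>0) c)"
proof (rule ext_pair)
  fix I \<tau>
  have finW: "finite W"
    by (rule finite_subset[of _ "{1..m}"]) (auto simp: W cells_def)
  show "vert m K (ind (I0, \<tau>0)) (I, \<tau>) = (\<Sum>w\<in>W. eps w (insert w \<tau>0) * ind (I0, insert w \<tau>0) (I, \<tau>))"
  proof (cases "I = I0 \<and> (\<exists>w\<in>W. \<tau> = insert w \<tau>0)")
    case True
    then obtain w where w: "w \<in> W" "\<tau> = insert w \<tau>0" "I = I0" by blast
    then have w': "w \<notin> \<tau>0" "(I, \<tau>) \<in> cells m K" by (auto simp: W)
    have fin: "finite \<tau>" using w'(2) simplicial_complexD(2)[OF K] by (auto simp: cells_def)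
    have "vert m K (ind (I0, \<tau>0)) (I, \<tau>) = (\<Sum>v\<in>\<tau>. if v = w then eps w \<tau> else 0)"
      using w w' by (auto simp: vert_def ind_def intro!: sum.cong)
    also have "\<dots> = eps w \<tau>" using fin w by simp
    also have "\<dots> = (\<Sum>u\<in>W. if u = w then eps w \<tau> else 0)" using finW w by simp
    also have "\<dots> = (\<Sum>u\<in>W. eps u (insert u \<tau>0) * ind (I0, insert u \<tau>0) (I, \<tau>))"
      using w w' by (intro sum.cong) (auto simp: ind_def W)
    finally show ?thesis .
  next
    case False
    have "vert m K (ind (I0, \<tau>0)) (I, \<tau>) = 0"
    proof (cases "(I, \<tau>) \<in> cells m K")
      case True
      have "ind (I0, \<tau>0) (I, \<tau> - {v}) = 0" if "v \<in> \<tau>" for v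
      proof (rule ccontr)
        assume "ind (I0, \<tau>0) (I, \<tau> - {v}) \<noteq> 0"
        then have e: "I = I0" "\<tau>0 = \<tau> - {v}" by (auto simp: ind_def split: if_splits)
        then have t: "\<tau> = insert v \<tau>0" using that by auto
        then have "v \<in> W" using True e(1) unfolding W by (simp add: e(2))
        then show False using False e(1) t by blast
      qed
      then show ?thesis using True by (simp add: vert_def)
    qed (simp add: vert_def)
    moreover have "ind (I0, insert w \<tau>0) (I, \<tau>) = 0" if "w \<in> W" for w
      using False that by (auto simp: ind_def)
    ultimately show ?thesis by simp
  qed
qed

lemma horiz_ind:
  assumes W: "W = {w\<in>I0. (I0 - {w}, \<tau>0) \<in> cells m K}" and I0: "I0 \<subseteq> {1..m}"
  shows "horiz m K (ind (I0, \<tau>0)) = (\<lambda>c. \<Sum>w\<in>W. (-1) ^ card \<tau>0 * eps w I0 * ind (I0 - {w}, \<tau>0) c)"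
proof (rule ext_pair)
  fix J \<tau>
  have finW: "finite W" using I0 by (intro finite_subset[of W "{1..m}"]) (auto simp: W)
  show "horiz m K (ind (I0, \<tau>0)) (J, \<tau>) = (\<Sum>w\<in>W. (-1) ^ card \<tau>0 * eps w I0 * ind (I0 - {w}, \<tau>0) (J, \<tau>))"
  proof (cases "\<tau> = \<tau>0 \<and> (\<exists>w\<in>W. J = I0 - {w})")
    case True
    then obtain w where w: "w \<in> W" "\<tau> = \<tau>0" "J = I0 - {w}" by blast
    then have w': "w \<in> I0" "(J, \<tau>) \<in> cells m K" by (auto simp: W)
    have "horiz m K (ind (I0, \<tau>0)) (J, \<tau>) = (-1) ^ card \<tau>0 * (\<Sum>i\<in>{1..m} - J. if i = w then eps w I0 else 0)"
    proof -
      have "eps i (insert i J) * ind (I0, \<tau>0) (insert i J, \<tau>) = (if i = w then eps w I0 else 0)" for i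
      proof (cases "i = w")
        case True
        then have "insert i J = I0" using w w' by auto
        then show ?thesis using True w by (simp add: ind_def)
      next
        case False
        then have "insert i J \<noteq> I0" using w w' by auto
        then show ?thesis using False by (simp add: ind_def)
      qed
      then show ?thesis using w w' by (simp add: horiz_def)
    qed
    also have "(\<Sum>i\<in>{1..m} - J. if i = w then eps w I0 else 0) = eps w I0"
    proof -
      have "w \<in> {1..m} - J" using w w' I0 by blast
      then show ?thesis by simp
    qed
    also have "(-1) ^ card \<tau>0 * eps w I0 = (\<Sum>u\<in>W. if u = w then (-1) ^ card \<tau>0 * eps w I0 else 0)" using finW w by simp
    also have "\<dots> = (\<Sum>u\<in>W. (-1) ^ card \<tau>0 * eps u I0 * ind (I0 - {u}, \<tau>0) (J, \<tau>))"
    proof (rule sum.cong[OF refl])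
      fix u assume "u \<in> W"
      then have "u \<in> I0" by (simp add: W)
      then have "I0 - {u} = J \<longleftrightarrow> u = w" using w w' by auto
      then show "(if u = w then (-1) ^ card \<tau>0 * eps w I0 else 0) = (-1) ^ card \<tau>0 * eps u I0 * ind (I0 - {u}, \<tau>0) (J, \<tau>)"
        using w(2) by (auto simp: ind_def)
    qed
    finally show ?thesis .
  next
    case False
    have "horiz m K (ind (I0, \<tau>0)) (J, \<tau>) = 0"
    proof (cases "(J, \<tau>) \<in> cells m K")
      case True
      have "ind (I0, \<tau>0) (insert i J, \<tau>) = 0" if i: "i \<in> {1..m} - J" for i
      proof (rule ccontr)
        assume "ind (I0, \<tau>0) (insert i J, \<tau>) \<noteq> 0"
        then have e: "I0 = insert i J" "\<tau> = \<tau>0" by (auto simp: ind_def split: if_splits)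
        then have t: "J = I0 - {i}" using i by auto
        then have "i \<in> W" using True e unfolding W by simp
        then show False using False e(2) t by blast
      qed
      then show ?thesis using True by (simp add: horiz_def)
    qed (simp add: horiz_def)
    moreover have "ind (I0 - {w}, \<tau>0) (J, \<tau>) = 0" if "w \<in> W" for w
      using False that by (auto simp: ind_def)
    ultimately show ?thesis by simp
  qed
qed

text \<open>
  In the theorem \<open>\<sigma>\<close> is \<open>[n+1]\<close>.  A vertex outside \<open>\<sigma>\<close> is the apex of a cone over \<open>\<partial>\<sigma>\<close> in \<open>K\<close>.  As \<open>\<sigma>\<close> has at
  least two vertices, its facets are nonempty, so that the full simplices on them are acyclic; the
  empty complex is not, in reduced cohomology.
\<close>
locale simplex_attachment =
  fixes m :: nat and K :: "nat set set" and \<sigma> :: "nat set"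
  assumes K: "simplicial_complex m K"
    and \<sigma>: "\<sigma> \<notin> K" "\<sigma> \<subset> {1..m}" "2 \<le> card \<sigma>"
    and coned: "\<And>i j. i \<in> \<sigma> \<Longrightarrow> j \<in> {1..m} - \<sigma> \<Longrightarrow> insert j \<sigma> - {i} \<in> K"
begin

abbreviation K' :: "nat set set" where "K' \<equiv> insert \<sigma> K"

lemma finite_sigma: "finite \<sigma>"
  using \<sigma>(2) finite_subset[of \<sigma> "{1..m}"] by blast

lemma face_K: "\<tau> \<in> K \<Longrightarrow> \<rho> \<subseteq> \<tau> \<Longrightarrow> \<rho> \<in> K"
  using simplicial_complexD(3)[OF K] .

lemma above_sigma: "\<sigma> \<subseteq> \<tau> \<Longrightarrow> \<tau> \<notin> K"
  using face_K \<sigma>(1) by blast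

lemma facet_sigma: assumes "i \<in> \<sigma>" shows "\<sigma> - {i} \<in> K"
proof -
  obtain j where "j \<in> {1..m} - \<sigma>" using \<sigma>(2) by blast
  from face_K[OF coned[OF assms this]] show ?thesis by blast
qed

lemma K': "simplicial_complex m K'"
proof -
  have "\<tau> \<in> K'" if "\<tau> \<subseteq> \<sigma>" for \<tau>
  proof (cases "\<tau> = \<sigma>")
    case False
    then obtain i where "i \<in> \<sigma>" "\<tau> \<subseteq> \<sigma> - {i}" using \<open>\<tau> \<subseteq> \<sigma>\<close> by blast
    then show ?thesis using face_K[OF facet_sigma] by blast
  qed simp
  then show ?thesis using K \<sigma>(2) by (auto simp: simplicial_complex_def)
qed

text \<open>
  The cells by which the double complex of the larger complex exceeds that of \<open>K\<close>.
\<close>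
definition top_cells :: "(nat set \<times> nat set) set" where
  "top_cells = {I. \<sigma> \<subseteq> I \<and> I \<subseteq> {1..m}} \<times> {\<sigma>}"

lemma cells_K': "cells m K' = cells m K \<union> top_cells"
  by (auto simp: cells_def top_cells_def)

lemma cells_top_cells: "c \<in> top_cells \<Longrightarrow> c \<notin> cells m K"
  using \<sigma>(1) by (auto simp: cells_def top_cells_def)

definition restr :: "(nat set \<times> nat set \<Rightarrow> real) \<Rightarrow> (nat set \<times> nat set \<Rightarrow> real)" where
  "restr x = (\<lambda>c. if c \<in> cells m K then x c else 0)"

lemma restr_linear: "pointwise_linear restr"
  by (auto simp: pointwise_linear_def restr_def)

lemma restr_total: "x \<in> total_cochains m K \<Longrightarrow> restr x = x"
  by (auto simp: restr_def supported_def)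

lemma restr_in_total: "restr x \<in> total_cochains m K"
  by (auto simp: restr_def supported_def)

lemma total_subset: "total_cochains m K \<subseteq> total_cochains m K'"
  by (auto simp: supported_def cells_K')

lemma vert_restr: "vert m K (restr x) = restr (vert m K' x)"
  by (rule ext_pair) (simp add: vert_def restr_def cells_face[OF K] cells_K')

lemma horiz_restr: "horiz m K (restr x) = restr (horiz m K' x)"
  by (rule ext_pair) (simp add: horiz_def restr_def cells_insert cells_K')

lemma restr_kernel: "{x \<in> total_cochains m K'. restr x = (\<lambda>c. 0)} = supported top_cells"
proof -
  have "restr x = (\<lambda>c. 0) \<longleftrightarrow> (\<forall>c\<in>cells m K. x c = 0)" for x
    by (auto simp: restr_def fun_eq_iff)
  then show ?thesis using cells_top_cells unfolding supported_def cells_K' by blast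
qed

lemma restr_vert_cycles: "x \<in> vert_cycles m K' \<Longrightarrow> restr x \<in> vert_cycles m K"
  by (simp add: vert_cycles_def vert_restr restr_in_total pointwise_linearD(3)[OF restr_linear])

text \<open>
  No simplex of \<open>K'\<close> properly contains \<open>\<sigma>\<close>.
\<close>
lemma top_vert_cycles: "supported top_cells \<subseteq> vert_cycles m K'"
proof
  fix x assume x: "x \<in> supported top_cells"
  have "vert m K' x (I, \<tau>) = 0" for I \<tau>
  proof (cases "(I, \<tau>) \<in> cells m K'")
    case True
    have "x (I, \<tau> - {v}) = 0" if v: "v \<in> \<tau>" for v
    proof -
      have "\<tau> - {v} \<noteq> \<sigma>"
      proof
        assume e: "\<tau> - {v} = \<sigma>"
        then have "\<tau> \<noteq> \<sigma>" "\<sigma> \<subseteq> \<tau>" using v by auto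
        then show False using True above_sigma by (auto simp: cells_def)
      qed
      then show ?thesis using x by (auto simp: supported_def top_cells_def)
    qed
    then show ?thesis by (simp add: vert_def)
  qed (simp add: vert_def)
  moreover have "x \<in> total_cochains m K'" using x by (auto simp: supported_def cells_K')
  ultimately show "x \<in> vert_cycles m K'" by (auto simp: vert_cycles_def)
qed

lemma horiz_top: "x \<in> supported top_cells \<Longrightarrow> horiz m K' x \<in> supported top_cells"
  unfolding supported_def
proof (intro CollectI allI impI)
  fix c assume x: "x \<in> {x. \<forall>p. p \<notin> top_cells \<longrightarrow> x p = 0}" and c: "c \<notin> top_cells"
  obtain J \<tau> where c': "c = (J, \<tau>)" by (cases c)
  show "horiz m K' x c = 0"
  proof (cases "c \<in> cells m K'")
    case True
    then have "\<tau> \<noteq> \<sigma>" using c by (auto simp: c' top_cells_def cells_def)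
    then have "x (insert i J, \<tau>) = 0" for i using x by (auto simp: top_cells_def)
    then show ?thesis by (simp add: c' horiz_def)
  qed (simp add: c' horiz_def)
qed

text \<open>
  The boundary of \<open>\<sigma>\<close> is also the boundary of the cone over \<open>\<partial>\<sigma>\<close> with apex any further vertex \<open>j\<close> of
  \<open>J\<close>, and the simplices of that cone belong to \<open>K\<close>.
\<close>
lemma coned_boundary:
  assumes J: "\<sigma> \<subset> J" "J \<subseteq> {1..m}" 
    and x: "\<And>\<tau>. \<tau> \<in> K \<Longrightarrow> \<tau> \<subseteq> J \<Longrightarrow> facet_sum x J \<tau> = 0"
  shows "facet_sum x J \<sigma> = 0"
proof -
  obtain j where j: "j \<in> J" "j \<notin> \<sigma>" using J by blast
  let ?t = "insert j \<sigma>"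
  have "0 = (\<Sum>v\<in>?t. eps v ?t * facet_sum x J (?t - {v}))"
    using facet_sum_facet_sum[of ?t x J] finite_sigma by simp
  also have "\<dots> = eps j ?t * facet_sum x J \<sigma> + (\<Sum>v\<in>\<sigma>. eps v ?t * facet_sum x J (?t - {v}))"
    using finite_sigma j by simp
  also have "(\<Sum>v\<in>\<sigma>. eps v ?t * facet_sum x J (?t - {v})) = 0"
  proof (rule sum.neutral, rule ballI)
    fix v assume "v \<in> \<sigma>"
    then have "?t - {v} \<in> K" "?t - {v} \<subseteq> J" using coned[of v j] j J by auto
    then show "eps v ?t * facet_sum x J (?t - {v}) = 0" using x by simp
  qed
  finally show ?thesis by simp
qed

text \<open>
  A vertical cycle \<open>x\<close> of \<open>K\<close> is the sum of a part \<open>x1\<close> that vanishes over \<open>I = \<sigma>\<close> and a part \<open>x2\<close>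
  that lives there.  Extended by zero, \<open>x1\<close> is a vertical cycle of the larger complex by
  \<open>coned_boundary\<close>.  The horizontal image of \<open>x2\<close> lives over the facets of \<open>\<sigma>\<close>; these span full
  simplices of \<open>K\<close>, so it is a vertical boundary.
\<close>
lemma restr_mixed_boundaries: "restr ` mixed_boundaries m K' = mixed_boundaries m K"
proof (intro subset_antisym subsetI)
  fix y assume "y \<in> restr ` mixed_boundaries m K'"
  then obtain z g where z: "z \<in> vert_cycles m K'" and "y = restr (\<lambda>c. horiz m K' z c + vert m K' g c)"
    by (auto simp: mixed_boundaries_def vert_boundaries_def)
  then have "y = (\<lambda>c. horiz m K (restr z) c + vert m K (restr g) c)"
    by (simp add: pointwise_linearD(1)[OF restr_linear] vert_restr horiz_restr)
  then show "y \<in> mixed_boundaries m K"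
    using restr_vert_cycles[OF z] restr_in_total[of g] unfolding mixed_boundaries_def vert_boundaries_def by blast
next
  fix y assume "y \<in> mixed_boundaries m K"
  then obtain x g where x: "x \<in> vert_cycles m K" and g: "g \<in> total_cochains m K"
    and y: "y = (\<lambda>c. horiz m K x c + vert m K g c)"
    by (auto simp: mixed_boundaries_def vert_boundaries_def)
  have x0: "x \<in> total_cochains m K" and vx: "vert m K x = (\<lambda>c. 0)" using x by (auto simp: vert_cycles_def)
  have fx: "facet_sum x I \<tau> = 0" if "(I, \<tau>) \<in> cells m K" for I \<tau>
    using vert_facet_sum[OF that, of x] vx by simp
  \<comment> \<open>Only over \<open>I = \<sigma>\<close> can a cocycle have a nonzero value on the boundary of \<open>\<sigma>\<close>.\<close>
  define x1 where "x1 = (\<lambda>(I, \<tau>). if I = \<sigma> then 0 else x (I, \<tau>))"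
  define x2 where "x2 = (\<lambda>(I, \<tau>). if I = \<sigma> then x (I, \<tau>) else 0)"
  have xsum: "x = (\<lambda>c. x1 c + x2 c)" by (rule ext_pair) (simp add: x1_def x2_def)
  have tot: "x1 \<in> total_cochains m K" "x2 \<in> total_cochains m K" using x0 by (auto simp: x1_def x2_def supported_def)
  have f1: "facet_sum x1 I \<tau> = (if I = \<sigma> then 0 else facet_sum x I \<tau>)" for I \<tau>
    by (simp add: facet_sum_def x1_def)
  have f2: "facet_sum x2 I \<tau> = (if I = \<sigma> then facet_sum x I \<tau> else 0)" for I \<tau>
    by (simp add: facet_sum_def x2_def)
  have "vert m K' x1 (I, \<tau>) = 0" for I \<tau>
  proof (cases "(I, \<tau>) \<in> cells m K'")
    case c: True
    show ?thesis
    proof (cases "(I, \<tau>) \<in> cells m K")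
      case True
      then show ?thesis using fx by (simp add: vert_facet_sum[OF c] f1)
    next
      case False
      then have I: "\<tau> = \<sigma>" "\<sigma> \<subseteq> I" "I \<subseteq> {1..m}" using c by (auto simp: cells_K' top_cells_def)
      have "facet_sum x I \<sigma> = 0" if "I \<noteq> \<sigma>"
        using fx I that by (intro coned_boundary) (auto simp: cells_def)
      then show ?thesis using I c by (simp add: vert_facet_sum f1)
    qed
  qed (simp add: vert_def)
  then have x1: "x1 \<in> vert_cycles m K'" using tot total_subset by (auto simp: vert_cycles_def)
  have "vert m K x2 (I, \<tau>) = 0" for I \<tau>
  proof (cases "(I, \<tau>) \<in> cells m K")
    case True
    then show ?thesis using fx[OF True] by (cases "I = \<sigma>") (simp_all add: vert_facet_sum f2)
  qed (simp add: vert_def)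
  then have x2: "x2 \<in> vert_cycles m K" using tot by (auto simp: vert_cycles_def)
  have "horiz m K x2 \<in> vert_boundaries m K"
  proof -
    let ?y = "horiz m K x2"
    have y: "?y \<in> vert_cycles m K" by (rule horiz_vert_cycles[OF K x2])
    have fy: "facet_sum ?y I \<tau> = 0" if "(I, \<tau>) \<in> cells m K" for I \<tau>
      using vert_facet_sum[OF that, of ?y] y by (simp add: vert_cycles_def)
    have ne: "\<exists>a. a \<in> \<sigma> - {i}" if "i \<in> \<sigma>" for i
    proof (rule ccontr)
      assume "\<nexists>a. a \<in> \<sigma> - {i}"
      then have "\<sigma> \<subseteq> {i}" by blast
      then show False using \<sigma>(3) card_mono[of "{i}" \<sigma>] by simp
    qed
    have support: "?y (J, \<tau>) = 0 \<or> (\<exists>b. b \<in> J \<and> J \<in> K)" for J \<tau>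
    proof (cases "\<exists>i\<in>\<sigma>. J = \<sigma> - {i}")
      case True
      then show ?thesis using ne facet_sigma by blast
    next
      case False
      have "insert i J \<noteq> \<sigma>" if "i \<in> {1..m} - J" for i
      proof
        assume "insert i J = \<sigma>"
        then have "i \<in> \<sigma>" "J = \<sigma> - {i}" using that by auto
        then show False using False by blast
      qed
      then have "?y (J, \<tau>) = 0" by (simp add: horiz_def x2_def)
      then show ?thesis by blast
    qed
    \<comment> \<open>Over a nonempty simplex \<open>J\<close> of \<open>K\<close> any vertex of \<open>J\<close> can serve as apex of a contraction.\<close>
    define b where "b J = (SOME b. b \<in> J)" for J :: "nat set"
    define g where "g = (\<lambda>(J, \<tau>). if (J, \<tau>) \<in> cells m K \<and> J \<in> K \<and> J \<noteq> {} then cone (b J) (\<lambda>\<rho>. ?y (J, \<rho>)) \<tau> else 0)"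
    have "vert m K g (J, \<tau>) = ?y (J, \<tau>)" for J \<tau>
    proof (cases "(J, \<tau>) \<in> cells m K")
      case True
      show ?thesis
      proof (cases "J \<in> K \<and> J \<noteq> {}")
        case J: True
        then have bJ: "b J \<in> J" unfolding b_def by (auto intro: someI_ex)
        have "vert m K g (J, \<tau>) = (\<Sum>v\<in>\<tau>. eps v \<tau> * cone (b J) (\<lambda>\<rho>. ?y (J, \<rho>)) (\<tau> - {v}))"
          using True J cells_face[OF K True] by (simp add: vert_def g_def)
        also have "\<dots> = ?y (J, \<tau>)"
        proof (rule cone_contraction)
          show "finite \<tau>" using True simplicial_complexD(2)[OF K] by (auto simp: cells_def)
          have "(J, insert (b J) \<tau>) \<in> cells m K"
            using True bJ J face_K[of J "insert (b J) \<tau>"] by (auto simp: cells_def)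
          from fy[OF this] show "(\<Sum>v\<in>insert (b J) \<tau>. eps v (insert (b J) \<tau>) * ?y (J, insert (b J) \<tau> - {v})) = 0"
            by (simp only: facet_sum_def)
        qed
        finally show ?thesis .
      next
        case J: False
        then have "?y (J, \<tau>) = 0" using support[of J \<tau>] by blast
        moreover have "vert m K g (J, \<tau>) = 0" using J by (auto simp: vert_def g_def)
        ultimately show ?thesis by simp
      qed
    next
      case False
      then show ?thesis by (simp add: vert_def horiz_def)
    qed
    then have "vert m K g = ?y" by auto
    moreover have "g \<in> total_cochains m K" by (auto simp: supported_def g_def)
    ultimately show ?thesis unfolding vert_boundaries_def by (metis imageI)
  qed
  then obtain g2 where g2: "g2 \<in> total_cochains m K" "horiz m K x2 = vert m K g2" by (auto simp: vert_boundaries_def)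
  have "y = restr (\<lambda>c. horiz m K' x1 c + vert m K' (\<lambda>c. g2 c + g c) c)"
    using g g2 tot
    by (simp add: pointwise_linearD(1)[OF restr_linear] vert_restr[symmetric] horiz_restr[symmetric] restr_total
      y xsum pointwise_linearD(1)[OF horiz_linear] pointwise_linearD(1)[OF vert_linear] add.assoc)
  moreover have "(\<lambda>c. g2 c + g c) \<in> total_cochains m K'" using g g2 by (auto simp: supported_def cells_K')
  ultimately show "y \<in> restr ` mixed_boundaries m K'" using x1 unfolding mixed_boundaries_def vert_boundaries_def by blast
qed

text \<open>
  On the additional cells the horizontal complex is that of all sets between \<open>\<sigma>\<close> and \<open>[m]\<close>.  Adjoining a
  fixed vertex \<open>j\<close> outside \<open>\<sigma>\<close> contracts it.
\<close>
lemma top_acyclic: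
  assumes x: "x \<in> supported top_cells" and hx: "horiz m K' x = (\<lambda>c. 0)"
  shows "x \<in> horiz m K' ` supported top_cells"
proof -
  obtain j where j: "j \<in> {1..m}" "j \<notin> \<sigma>" using \<sigma>(2) by blast
  let ?s = "(-1) ^ card \<sigma> :: real"
  have s2: "?s * ?s = 1" by (simp add: power_add[symmetric])
  \<comment> \<open>The contraction moves the value at \<open>I - {j}\<close> to \<open>I\<close>; both signs undo those of the differential.\<close>
  define y where "y = (\<lambda>(I, \<tau>). if (I, \<tau>) \<in> top_cells \<and> j \<in> I then ?s * eps j I * x (I - {j}, \<sigma>) else 0)"
  have y: "y \<in> supported top_cells" by (auto simp: supported_def y_def)
  have "horiz m K' y (J, \<tau>) = x (J, \<tau>)" for J \<tau>
  proof (cases "(J, \<tau>) \<in> top_cells")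
    case True
    then have J: "\<tau> = \<sigma>" "\<sigma> \<subseteq> J" "J \<subseteq> {1..m}" by (auto simp: top_cells_def)
    have h: "horiz m K' z (I, \<sigma>) = ?s * (\<Sum>i\<in>{1..m} - I. eps i (insert i I) * z (insert i I, \<sigma>))"
      if "\<sigma> \<subseteq> I" "I \<subseteq> {1..m}" for z I
      using that by (simp add: horiz_def cells_K' top_cells_def)
    have yi: "y (insert i J, \<sigma>) = (if j \<in> insert i J then ?s * eps j (insert i J) * x (insert i J - {j}, \<sigma>) else 0)"
      if "i \<in> {1..m} - J" for i
      using that J by (auto simp: y_def top_cells_def)
    show ?thesis
    proof (cases "j \<in> J")
      case False
      have "(\<Sum>i\<in>{1..m} - J. eps i (insert i J) * y (insert i J, \<sigma>)) = (\<Sum>i\<in>{1..m} - J. if i = j then ?s * x (J, \<sigma>) else 0)"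
        using False yi by (intro sum.cong) (auto simp: mult.assoc[symmetric] mult.commute[of _ ?s])
      also have "\<dots> = ?s * x (J, \<sigma>)" using False j by simp
      finally show ?thesis using J s2 by (simp add: h mult.assoc[symmetric])
    next
      case jJ: True
      let ?J = "J - {j}"
      have J': "\<sigma> \<subseteq> ?J" "?J \<subseteq> {1..m}" using J j by auto
      have "{1..m} - ?J = insert j ({1..m} - J)" using jJ J by auto
      then have "0 = eps j J * x (J, \<sigma>) + (\<Sum>i\<in>{1..m} - J. eps i (insert i ?J) * x (insert i ?J, \<sigma>))"
        using h[OF J', of x] hx jJ by (simp add: insert_absorb)
      then have e: "(\<Sum>i\<in>{1..m} - J. eps i (insert i ?J) * x (insert i ?J, \<sigma>)) = - (eps j J * x (J, \<sigma>))" by simp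
      have "(\<Sum>i\<in>{1..m} - J. eps i (insert i J) * y (insert i J, \<sigma>))
          = (\<Sum>i\<in>{1..m} - J. - (?s * eps j J * (eps i (insert i ?J) * x (insert i ?J, \<sigma>))))"
      proof (rule sum.cong[OF refl])
        fix i assume i: "i \<in> {1..m} - J"
        let ?L = "insert i J"
        have L: "finite ?L" "i \<in> ?L" "j \<in> ?L" "i \<noteq> j" "?L - {i} = J" "?L - {j} = insert i ?J"
          using i jJ J finite_subset[of J "{1..m}"] by auto
        from eps_swap[OF L(1-4)] have "eps i ?L * eps j J = - (eps j ?L * eps i (insert i ?J))" unfolding L(5,6) .
        then have signs: "eps i ?L * eps j ?L = - (eps j J * eps i (insert i ?J))"
          by (rule sign_exchange) simp_all
        have "y (?L, \<sigma>) = ?s * eps j ?L * x (insert i ?J, \<sigma>)"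
          using yi[OF i] jJ by (simp only: L(6) insertI2 if_True)
        then have "eps i ?L * y (?L, \<sigma>) = (eps i ?L * eps j ?L) * (?s * x (insert i ?J, \<sigma>))"
          by (simp only: ac_simps)
        also have "\<dots> = - (?s * eps j J * (eps i (insert i ?J) * x (insert i ?J, \<sigma>)))"
          unfolding signs mult_minus_left neg_equal_iff_equal by (simp only: ac_simps)
        finally show "eps i ?L * y (?L, \<sigma>) = - (?s * eps j J * (eps i (insert i ?J) * x (insert i ?J, \<sigma>)))" .
      qed
      also have "\<dots> = ?s * eps j J * - (\<Sum>i\<in>{1..m} - J. eps i (insert i ?J) * x (insert i ?J, \<sigma>))"
        by (simp add: sum_negf sum_distrib_left)
      also have "\<dots> = ?s * x (J, \<sigma>)" unfolding e by (simp add: mult.assoc[symmetric])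
      finally show ?thesis using J s2 by (simp add: h mult.assoc[symmetric])
    qed
  next
    case False
    then show ?thesis using x horiz_top[OF y] by (simp add: supported_def)
  qed
  then have "horiz m K' y = x" by auto
  then show ?thesis using y by blast
qed

text \<open>
  The obstruction for a mixed boundary supported on the additional cells to be the horizontal image of a
  function supported there.
\<close>
definition \<theta> :: "(nat set \<times> nat set \<Rightarrow> real) \<Rightarrow> real" where
  "\<theta> x = horiz m K' x (\<sigma>, \<sigma>)"

text \<open>
  If \<open>x = horiz z + vert g\<close> then \<open>horiz x = - vert (horiz g)\<close>.  Away from \<open>(\<sigma>, \<sigma>)\<close> this vanishes by
  \<open>coned_boundary\<close>, so \<open>\<theta> x = 0\<close> makes \<open>x\<close> a horizontal cycle and \<open>top_acyclic\<close> applies.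
\<close>
lemma mixed_boundaries_top_kernel:
  "{x \<in> mixed_boundaries m K' \<inter> supported top_cells. \<theta> x = 0} = horiz m K' ` supported top_cells"
proof (intro subset_antisym subsetI)
  fix x assume "x \<in> {x \<in> mixed_boundaries m K' \<inter> supported top_cells. \<theta> x = 0}"
  then have x: "x \<in> mixed_boundaries m K'" "x \<in> supported top_cells" "\<theta> x = 0" by auto
  obtain z g where "x = (\<lambda>c. horiz m K' z c + vert m K' g c)" using x(1) by (auto simp: mixed_boundaries_def vert_boundaries_def)
  then have hx: "horiz m K' x = (\<lambda>c. - vert m K' (horiz m K' g) c)"
    by (simp add: pointwise_linearD(1)[OF horiz_linear] horiz_horiz vert_horiz[OF K'])
  have h: "horiz m K' x \<in> supported top_cells" by (rule horiz_top[OF x(2)])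
  have "horiz m K' x (J, \<tau>) = 0" for J \<tau>
  proof (cases "(J, \<tau>) \<in> top_cells")
    case True
    then have J: "\<tau> = \<sigma>" "\<sigma> \<subseteq> J" "J \<subseteq> {1..m}" and c: "(J, \<sigma>) \<in> cells m K'" by (auto simp: top_cells_def cells_def)
    show ?thesis
    proof (cases "J = \<sigma>")
      case True
      then show ?thesis using x(3) J by (simp add: \<theta>_def)
    next
      case False
      have "facet_sum (horiz m K' g) J \<sigma> = 0"
      proof (rule coned_boundary)
        fix \<rho> assume \<rho>: "\<rho> \<in> K" "\<rho> \<subseteq> J"
        then have "(J, \<rho>) \<in> cells m K'" "(J, \<rho>) \<notin> top_cells" using J \<sigma>(1) by (auto simp: cells_def top_cells_def)
        then show "facet_sum (horiz m K' g) J \<rho> = 0"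
          using h fun_cong[OF hx, of "(J, \<rho>)"] vert_facet_sum[of J \<rho> m K' "horiz m K' g"] by (auto simp: supported_def)
      qed (use False J in auto)
      then show ?thesis using J c by (simp add: hx vert_facet_sum)
    qed
  next
    case False
    then show ?thesis using h by (simp add: supported_def)
  qed
  then have "horiz m K' x = (\<lambda>c. 0)" by auto
  then show "x \<in> horiz m K' ` supported top_cells" by (rule top_acyclic[OF x(2)])
next
  fix x assume "x \<in> horiz m K' ` supported top_cells"
  then obtain y where y: "y \<in> supported top_cells" "x = horiz m K' y" by blast
  then have "x \<in> horiz m K' ` vert_cycles m K'" using top_vert_cycles by blast
  moreover have "(\<lambda>c. 0) \<in> vert_boundaries m K'" using vert_boundaries_subspace by (auto simp: fun_subspace_def)
  ultimately have "x \<in> mixed_boundaries m K'" unfolding mixed_boundaries_def by force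
  then show "x \<in> {x \<in> mixed_boundaries m K' \<inter> supported top_cells. \<theta> x = 0}"
    using y horiz_top by (simp add: \<theta>_def horiz_horiz)
qed

text \<open>
  Let \<open>a\<close> be the rank of \<open>horiz(A)\<close>, where \<open>A\<close> consists of the functions supported on the additional
  cells.  The double complex grows by \<open>rank A = 2 a\<close> and the mixed boundaries by \<open>a\<close>, or by \<open>a + 1\<close> if
  the obstruction \<open>\<theta>\<close> is nonzero; by \<open>rank_HH\<close> the changes cancel up to the contribution of \<open>\<theta>\<close>.
\<close>
theorem rank_HH_attachment:
  "rank (HH m K') + (if \<exists>x\<in>mixed_boundaries m K' \<inter> supported top_cells. \<theta> x \<noteq> 0 then 2 else 0) = rank (HH m K)"
proof -
  let ?A = "supported top_cells" and ?Q = "mixed_boundaries m K'"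
  note fd = total_fin_dim_space[OF K']
  have A: "?A \<subseteq> total_cochains m K'" by (auto simp: supported_def cells_K')
  have Q: "?Q \<subseteq> total_cochains m K'" using mixed_boundaries_vert_cycles[OF K'] by (auto simp: vert_cycles_def)
  have A_fd: "fin_dim_space (fun_space ?A)" by (rule fun_subspace_fin_dim_space[OF fd A fun_subspace_supported])
  have Q_fd: "fin_dim_space (fun_space ?Q)" by (rule fun_subspace_fin_dim_space[OF fd Q mixed_boundaries_subspace])
  have QA_fd: "fin_dim_space (fun_space (?Q \<inter> ?A))"
    by (rule fun_subspace_fin_dim_space[OF Q_fd _ fun_subspace_Int[OF mixed_boundaries_subspace fun_subspace_supported]]) simp
  have "restr ` total_cochains m K' = total_cochains m K"
  proof (intro subset_antisym subsetI)
    fix x assume "x \<in> total_cochains m K"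
    then show "x \<in> restr ` total_cochains m K'" using restr_total[of x] total_subset by force
  qed (use restr_in_total in auto)
  then have total_cochains: "fun_rank (total_cochains m K') = fun_rank (total_cochains m K) + fun_rank ?A"
    using fun_rank_nullity[OF fd restr_linear] restr_kernel by simp
  have "{x \<in> ?A. horiz m K' x = (\<lambda>c. 0)} = horiz m K' ` ?A"
    using top_acyclic horiz_top horiz_horiz by blast
  then have acyclic: "fun_rank ?A = 2 * fun_rank (horiz m K' ` ?A)"
    using fun_rank_nullity[OF A_fd horiz_linear, of m K'] by simp
  have "{x \<in> ?Q. restr x = (\<lambda>c. 0)} = ?Q \<inter> ?A" using restr_kernel Q by blast
  then have 1: "fun_rank ?Q = fun_rank (mixed_boundaries m K) + fun_rank (?Q \<inter> ?A)"
    using fun_rank_nullity[OF Q_fd restr_linear] restr_mixed_boundaries by simp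
  have "linear_on (fun_space (?Q \<inter> ?A)) real_line \<theta>"
    by (simp add: linear_on_def \<theta>_def pointwise_linearD[OF horiz_linear])
  from rank_functional[OF QA_fd this]
  have 2: "fun_rank (?Q \<inter> ?A) = fun_rank (horiz m K' ` ?A) + (if \<exists>x\<in>?Q \<inter> ?A. \<theta> x \<noteq> 0 then 1 else 0)"
    unfolding fun_space_simps mixed_boundaries_top_kernel .
  show ?thesis
    using rank_HH[OF K] rank_HH[OF K'] total_cochains acyclic 1 2 by (auto split: if_splits)
qed

section \<open>Vanishing and non-vanishing of the obstruction\<close>

text \<open>
  At \<open>(\<sigma> \<union> {j}, \<sigma>)\<close> a function supported on the additional cells can be read off from its value on the
  boundary of the simplex \<open>\<sigma> \<union> {j}\<close>.  In this form \<open>\<theta>\<close> ignores vertical boundaries.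
\<close>
lemma theta_top:
  assumes x: "x \<in> supported top_cells"
  shows "\<theta> x = (-1) ^ card \<sigma> * (\<Sum>j\<in>{1..m} - \<sigma>. facet_sum x (insert j \<sigma>) (insert j \<sigma>))"
proof -
  have "facet_sum x (insert j \<sigma>) (insert j \<sigma>) = eps j (insert j \<sigma>) * x (insert j \<sigma>, \<sigma>)" if j: "j \<in> {1..m} - \<sigma>" for j
  proof -
    have "x (insert j \<sigma>, insert j \<sigma> - {v}) = 0" if "v \<in> \<sigma>" for v
    proof -
      have "insert j \<sigma> - {v} \<noteq> \<sigma>" using that by blast
      then have "(insert j \<sigma>, insert j \<sigma> - {v}) \<notin> top_cells" by (simp add: top_cells_def)
      then show ?thesis using x by (simp add: supported_def)
    qed
    then show ?thesis using finite_sigma j by (simp add: facet_sum_def)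
  qed
  moreover have "(\<sigma>, \<sigma>) \<in> cells m K'" using \<sigma>(2) by (auto simp: cells_def)
  ultimately show ?thesis by (simp add: \<theta>_def horiz_def)
qed

text \<open>
  The vertical part of \<open>x\<close> does not contribute to \<open>\<theta>\<close>, and the horizontal part contributes, for every
  ordered pair \<open>(j, k)\<close>, a signed evaluation of \<open>z\<close> on the boundary of \<open>\<sigma> \<union> {j}\<close> inside
  \<open>\<sigma> \<union> {j, k}\<close>.  The contributions of \<open>(j, k)\<close> and \<open>(k, j)\<close> cancel, because the remaining facets
  of \<open>\<sigma> \<union> {j, k}\<close> are simplices, on whose boundaries the cocycle \<open>z\<close> vanishes.
\<close>
lemma theta_zero:
  assumes linked: "\<And>i j k. i \<in> \<sigma> \<Longrightarrow> j \<in> {1..m} - \<sigma> \<Longrightarrow> k \<in> {1..m} - \<sigma> \<Longrightarrow> j \<noteq> k \<Longrightarrow> \<sigma> \<union> {j, k} - {i} \<in> K"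
    and x: "x \<in> mixed_boundaries m K'" "x \<in> supported top_cells"
  shows "\<theta> x = 0"
proof -
  obtain z g where z: "z \<in> vert_cycles m K'" and xz: "x = (\<lambda>c. horiz m K' z c + vert m K' g c)"
    using x(1) by (auto simp: mixed_boundaries_def vert_boundaries_def)
  let ?s = "(-1) ^ card \<sigma> :: real"
  let ?g = "\<lambda>j k. eps k (insert k (insert j \<sigma>)) * facet_sum z (insert k (insert j \<sigma>)) (insert j \<sigma>)"
  have "facet_sum x (insert j \<sigma>) (insert j \<sigma>) = ?s * (\<Sum>k\<in>{1..m} - \<sigma> - {j}. ?g j k)" if j: "j \<in> {1..m} - \<sigma>" for j
  proof -
    let ?t = "insert j \<sigma>"
    have fin: "finite ?t" using finite_sigma by simp
    have face: "(?t, ?t - {v}) \<in> cells m K'" if "v \<in> ?t" for v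
      using that j \<sigma>(2) coned[of v j] by (cases "v = j") (auto simp: cells_def)
    have card: "card (?t - {v}) = card \<sigma>" if "v \<in> ?t" for v
      using fin j finite_sigma that by simp
    have "facet_sum (vert m K' g) ?t ?t = (\<Sum>v\<in>?t. eps v ?t * facet_sum g ?t (?t - {v}))"
      unfolding facet_sum_def[of "vert m K' g"] using face by (simp add: vert_facet_sum)
    then have v0: "facet_sum (vert m K' g) ?t ?t = 0" using facet_sum_facet_sum[OF fin] by simp
    have sets: "{1..m} - ?t = {1..m} - \<sigma> - {j}" by auto
    have "facet_sum (horiz m K' z) ?t ?t
        = (\<Sum>v\<in>?t. eps v ?t * (?s * (\<Sum>k\<in>{1..m} - \<sigma> - {j}. eps k (insert k ?t) * z (insert k ?t, ?t - {v}))))"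
      unfolding facet_sum_def using face card by (simp add: horiz_def sets del: One_nat_def)
    also have "\<dots> = (\<Sum>v\<in>?t. \<Sum>k\<in>{1..m} - \<sigma> - {j}. ?s * (eps k (insert k ?t) * (eps v ?t * z (insert k ?t, ?t - {v}))))"
      unfolding sum_distrib_left by (intro sum.cong refl) (simp only: ac_simps)
    also have "\<dots> = (\<Sum>k\<in>{1..m} - \<sigma> - {j}. \<Sum>v\<in>?t. ?s * (eps k (insert k ?t) * (eps v ?t * z (insert k ?t, ?t - {v}))))"
      by (rule sum.swap)
    also have "\<dots> = ?s * (\<Sum>k\<in>{1..m} - \<sigma> - {j}. ?g j k)"
      unfolding facet_sum_def sum_distrib_left ..
    finally have h: "facet_sum (horiz m K' z) ?t ?t = ?s * (\<Sum>k\<in>{1..m} - \<sigma> - {j}. ?g j k)" .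
    have "facet_sum x ?t ?t = facet_sum (horiz m K' z) ?t ?t + facet_sum (vert m K' g) ?t ?t"
      unfolding xz facet_sum_def by (simp only: distrib_left sum.distrib)
    then show ?thesis using v0 h by simp
  qed
  then have "\<theta> x = ?s * (\<Sum>j\<in>{1..m} - \<sigma>. ?s * (\<Sum>k\<in>{1..m} - \<sigma> - {j}. ?g j k))"
    using theta_top[OF x(2)] by simp
  also have "\<dots> = ?s * (?s * (\<Sum>j\<in>{1..m} - \<sigma>. \<Sum>k\<in>{1..m} - \<sigma> - {j}. ?g j k))"
    by (simp only: sum_distrib_left)
  also have "(\<Sum>j\<in>{1..m} - \<sigma>. \<Sum>k\<in>{1..m} - \<sigma> - {j}. ?g j k) = 0"
  proof (rule antisymmetric_sum_zero)
    fix j k assume jk: "j \<in> {1..m} - \<sigma>" "k \<in> {1..m} - \<sigma>" "j \<noteq> k"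
    let ?r = "insert k (insert j \<sigma>)"
    have fin: "finite ?r" using finite_sigma by simp
    have "0 = (\<Sum>v\<in>?r. eps v ?r * facet_sum z ?r (?r - {v}))"
      using facet_sum_facet_sum[OF fin, of z ?r] by simp
    also have "\<dots> = eps k ?r * facet_sum z ?r (?r - {k}) + (eps j ?r * facet_sum z ?r (?r - {j})
        + (\<Sum>v\<in>\<sigma>. eps v ?r * facet_sum z ?r (?r - {v})))"
      using finite_sigma jk by simp
    also have "(\<Sum>v\<in>\<sigma>. eps v ?r * facet_sum z ?r (?r - {v})) = 0"
    proof (rule sum.neutral, rule ballI)
      fix v assume v: "v \<in> \<sigma>"
      have "?r = \<sigma> \<union> {j, k}" by auto
      then have "(?r, ?r - {v}) \<in> cells m K'" using linked[OF v jk] jk \<sigma>(2) by (auto simp: cells_def)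
      then have "facet_sum z ?r (?r - {v}) = 0"
        using z vert_facet_sum[of ?r "?r - {v}" m K' z] by (simp add: vert_cycles_def)
      then show "eps v ?r * facet_sum z ?r (?r - {v}) = 0" by simp
    qed
    also have "?r - {k} = insert j \<sigma>" using jk by auto
    also have "?r - {j} = insert k \<sigma>" using jk by auto
    finally show "?g j k = - ?g k j" by (simp add: insert_commute)
  qed simp
  finally show ?thesis by simp
qed

lemma mixed_boundaries_closed:
  assumes "x \<in> mixed_boundaries m L" "y \<in> mixed_boundaries m L"
  shows "(\<lambda>c. a * x c + b * y c) \<in> mixed_boundaries m L"
  using mixed_boundaries_subspace[of m L] assms by (simp add: fun_subspace_def)

text \<open>
  Start with the indicator of the simplex \<open>f = \<sigma> \<union> {j} - {i}\<close> over \<open>\<sigma> \<union> {j, k}\<close>, a vertical cycle because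
  \<open>f\<close> has no coface there.  Its horizontal image is a signed sum of the indicators of \<open>f\<close> over \<open>\<sigma> \<union> {j}\<close> and over
  \<open>\<sigma> \<union> {j, k} - {i}\<close>.  Over the second set, \<open>f\<close> is the only coface of \<open>f - {l}\<close>, since
  \<open>\<sigma> \<union> {j, k} - {i, l}\<close> is missing; so this indicator is a vertical boundary.  Over the first set,
  \<open>\<sigma> - {i}\<close> has exactly the cofaces \<open>\<sigma>\<close> and \<open>f\<close>, so the indicator of \<open>f\<close> can be traded for that of \<open>\<sigma>\<close>.
  Hence the indicator of \<open>(\<sigma> \<union> {j}, \<sigma>)\<close> is a mixed boundary, and \<open>\<theta>\<close> is \<open>\<plusminus>1\<close> on it.
\<close>
lemma theta_nonzero:
  assumes jk: "j \<in> {1..m} - \<sigma>" "k \<in> {1..m} - \<sigma>" "j \<noteq> k"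
    and unlinked: "\<And>i. i \<in> \<sigma> \<Longrightarrow> \<sigma> \<union> {j, k} - {i} \<notin> K"
    and il: "i \<in> \<sigma>" "l \<in> \<sigma>" "i \<noteq> l" "\<sigma> \<union> {j, k} - {i, l} \<notin> K"
  shows "\<exists>x\<in>mixed_boundaries m K' \<inter> supported top_cells. \<theta> x \<noteq> 0"
proof -
  let ?r = "\<sigma> \<union> {j, k}"
  let ?t = "insert j \<sigma>"
  let ?f = "?t - {i}"
  have r: "?r \<subseteq> {1..m}" using jk \<sigma>(2) by auto
  have f: "?f \<in> K" by (rule coned[OF il(1) jk(1)])
  have no: "\<tau> \<notin> K'" if "\<sigma> \<subset> \<tau>" for \<tau> using that above_sigma[of \<tau>] by auto
  have v1: "vert m K' (ind (?r, ?f)) = (\<lambda>c. \<Sum>w\<in>{}. eps w (insert w ?f) * ind (?r, insert w ?f) c)"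
  proof (rule vert_ind[OF K'])
    have "insert w ?f \<notin> K' \<or> \<not> insert w ?f \<subseteq> ?r" if w: "w \<notin> ?f" for w
    proof -
      consider "w = i" | "w = k" | "w \<notin> ?r" using w by blast
      then show ?thesis
      proof cases
        case 1
        then have "insert w ?f = ?t" using il jk by auto
        then show ?thesis using no[of ?t] jk by auto
      next
        case 2
        then have "insert w ?f = ?r - {i}" using il jk by auto
        moreover have "?r - {i} \<noteq> \<sigma>" using il by auto
        ultimately show ?thesis using unlinked[OF il(1)] by auto
      qed auto
    qed
    then show "{} = {w. w \<notin> ?f \<and> (?r, insert w ?f) \<in> cells m K'}"
      by (auto simp: cells_def)
  qed
  have z: "ind (?r, ?f) \<in> vert_cycles m K'"
  proof -
    have "(?r, ?f) \<in> cells m K'" using f r by (auto simp: cells_def)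
    then show ?thesis using v1 by (auto simp: vert_cycles_def supported_def ind_def)
  qed
  have h1: "horiz m K' (ind (?r, ?f)) = (\<lambda>c. \<Sum>w\<in>{k, i}. (-1) ^ card ?f * eps w ?r * ind (?r - {w}, ?f) c)"
  proof (rule horiz_ind[OF _ r])
    show "{k, i} = {w \<in> ?r. (?r - {w}, ?f) \<in> cells m K'}"
      using f r jk il by (auto simp: cells_def)
  qed
  have e: "insert i (\<sigma> - {i}) = \<sigma>" "insert j (\<sigma> - {i}) = ?f" "insert l (?f - {l}) = ?f" "?r - {k} = ?t" "i \<noteq> j" "k \<noteq> i"
    using il jk by auto
  have v2: "vert m K' (ind (?t, \<sigma> - {i})) = (\<lambda>c. \<Sum>w\<in>{i, j}. eps w (insert w (\<sigma> - {i})) * ind (?t, insert w (\<sigma> - {i})) c)"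
  proof (rule vert_ind[OF K'])
    have "(?t, \<sigma>) \<in> cells m K'" "(?t, ?f) \<in> cells m K'" using f r by (auto simp: cells_def)
    then have "w \<notin> \<sigma> - {i} \<and> (?t, insert w (\<sigma> - {i})) \<in> cells m K'" if "w \<in> {i, j}" for w
      using that e(1,2) jk by fastforce
    moreover have "w \<in> {i, j}" if "w \<notin> \<sigma> - {i}" "(?t, insert w (\<sigma> - {i})) \<in> cells m K'" for w
      using that by (auto simp: cells_def)
    ultimately show "{i, j} = {w. w \<notin> \<sigma> - {i} \<and> (?t, insert w (\<sigma> - {i})) \<in> cells m K'}"
      by blast
  qed
  have v3: "vert m K' (ind (?r - {i}, ?f - {l})) = (\<lambda>c. \<Sum>w\<in>{l}. eps w (insert w (?f - {l})) * ind (?r - {i}, insert w (?f - {l})) c)"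
  proof (rule vert_ind[OF K'])
    have "insert k (?f - {l}) = ?r - {i, l}" using il jk by auto
    moreover have "?r - {i, l} \<noteq> \<sigma>" using il by auto
    ultimately have "insert k (?f - {l}) \<notin> K'" using il(4) by auto
    then have "w = l" if "w \<notin> ?f - {l}" "(?r - {i}, insert w (?f - {l})) \<in> cells m K'" for w
      using that by (auto simp: cells_def)
    moreover have "(?r - {i}, ?f) \<in> cells m K'" using f r by (auto simp: cells_def)
    then have "(?r - {i}, insert l (?f - {l})) \<in> cells m K'" unfolding e(3) .
    ultimately show "{l} = {w. w \<notin> ?f - {l} \<and> (?r - {i}, insert w (?f - {l})) \<in> cells m K'}"
      by blast
  qed
  have tot: "ind (?t, \<sigma> - {i}) \<in> total_cochains m K'" "ind (?r - {i}, ?f - {l}) \<in> total_cochains m K'"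
    using facet_sigma[OF il(1)] face_K[OF f, of "?f - {l}"] r by (auto simp: supported_def ind_def cells_def)
  let ?s = "(-1) ^ card ?f :: real"
  have 1: "horiz m K' (ind (?r, ?f)) = (\<lambda>c. ?s * eps k ?r * ind (?t, ?f) c + ?s * eps i ?r * ind (?r - {i}, ?f) c)"
    using h1 e by simp
  have 2: "vert m K' (ind (?t, \<sigma> - {i})) = (\<lambda>c. eps i \<sigma> * ind (?t, \<sigma>) c + eps j ?f * ind (?t, ?f) c)"
    using v2 unfolding sum.insert[OF finite.insertI[OF finite.emptyI], of i j] using e by simp
  have 3: "vert m K' (ind (?r - {i}, ?f - {l})) = (\<lambda>c. eps l ?f * ind (?r - {i}, ?f) c)"
  proof -
    have "insert l ?f = ?f" using il by auto
    then show ?thesis using v3 by simp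
  qed
  have Q: "horiz m K' (ind (?r, ?f)) \<in> mixed_boundaries m K'" "vert m K' (ind (?t, \<sigma> - {i})) \<in> mixed_boundaries m K'"
    "vert m K' (ind (?r - {i}, ?f - {l})) \<in> mixed_boundaries m K'"
  proof -
    have "(\<lambda>c. 0) \<in> vert_boundaries m K'" using vert_boundaries_subspace by (auto simp: fun_subspace_def)
    then show "horiz m K' (ind (?r, ?f)) \<in> mixed_boundaries m K'" using z unfolding mixed_boundaries_def by force
    show "vert m K' (ind (?t, \<sigma> - {i})) \<in> mixed_boundaries m K'" "vert m K' (ind (?r - {i}, ?f - {l})) \<in> mixed_boundaries m K'"
      using tot vert_boundaries_mixed_boundaries[of m K'] by (auto simp: vert_boundaries_def)
  qed
  let ?a = "eps j ?f * eps i \<sigma>"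
  \<comment> \<open>The coefficients solve the relations 1, 2 and 3 for the indicator of \<open>(?t, \<sigma>)\<close>.\<close>
  have "(\<lambda>c. eps i \<sigma> * vert m K' (ind (?t, \<sigma> - {i})) c + (- (?s * eps k ?r) * ?a) *
      (1 * horiz m K' (ind (?r, ?f)) c + (- (?s * eps i ?r * eps l ?f)) * vert m K' (ind (?r - {i}, ?f - {l})) c))
    \<in> mixed_boundaries m K'" (is "?x \<in> _")
    by (intro mixed_boundaries_closed Q)
  also have "?x = ind (?t, \<sigma>)"
  proof
    fix c
    have s2: "?s * ?s = 1" by (simp add: power_add[symmetric])
    have "1 * horiz m K' (ind (?r, ?f)) c + (- (?s * eps i ?r * eps l ?f)) * vert m K' (ind (?r - {i}, ?f - {l})) c
        = ?s * eps k ?r * ind (?t, ?f) c + (?s * eps i ?r * ind (?r - {i}, ?f) c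
          - (eps l ?f * eps l ?f) * (?s * eps i ?r * ind (?r - {i}, ?f) c))"
      unfolding 1 3 by (simp add: algebra_simps del: eps_square)
    also have "\<dots> = ?s * eps k ?r * ind (?t, ?f) c" by simp
    finally have "?x c = (eps i \<sigma> * eps i \<sigma>) * ind (?t, \<sigma>) c + ?a * ind (?t, ?f) c
        - ((?s * ?s) * (eps k ?r * eps k ?r)) * (?a * ind (?t, ?f) c)"
      unfolding 2 by (simp add: algebra_simps del: eps_square)
    then show "?x c = ind (?t, \<sigma>) c" by (simp only: s2 eps_square mult_1_left add_diff_cancel_right')
  qed
  finally have xQ: "ind (?t, \<sigma>) \<in> mixed_boundaries m K'" .
  have xA: "ind (?t, \<sigma>) \<in> supported top_cells"
    using r by (auto simp: supported_def ind_def top_cells_def)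
  have "\<theta> (ind (?t, \<sigma>)) = (-1) ^ card \<sigma> * eps j ?t"
  proof -
    have "(?t - {j}, \<sigma>) = (\<sigma>, \<sigma>)" using jk by auto
    have h: "horiz m K' (ind (?t, \<sigma>)) = (\<lambda>c. \<Sum>w\<in>{j}. (-1) ^ card \<sigma> * eps w ?t * ind (?t - {w}, \<sigma>) c)"
    proof (rule horiz_ind)
      show "{j} = {w \<in> ?t. (?t - {w}, \<sigma>) \<in> cells m K'}"
        using r jk by (auto simp: cells_def)
    qed (use r in auto)
    show ?thesis using jk unfolding \<theta>_def h by (simp add: ind_def)
  qed
  then show ?thesis using xQ xA by force
qed

section \<open>Cohomology over the simplex and two further vertices\<close>

context
  fixes j k :: nat and p :: int and r :: "nat set" and L :: "nat set set"
  assumes jk: "j \<in> {1..m} - \<sigma>" "k \<in> {1..m} - \<sigma>" "j \<noteq> k"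
    and p: "p + 1 = int (card \<sigma>)"
  defines "r \<equiv> \<sigma> \<union> {j, k}" and "L \<equiv> full_subcomplex K r"
begin

lemma L: "finite_complex L"
  unfolding L_def by (rule full_subcomplex_finite[OF K])

lemma fin_r: "finite r"
  using finite_sigma by (simp add: r_def)

lemma cocycles_rank: "rank (vsub (cochains L p) (cocycles L p)) = rank (red_cohom L p) + rank (vsub (cochains L p) (coboundaries L p))"
  by (rule red_cohom_rank(2)[OF L])

text \<open>
  No simplex contains \<open>\<sigma>\<close>, so every simplex of \<open>L\<close> misses some \<open>i \<in> \<sigma>\<close> and stays a simplex when \<open>j\<close> is
  added: \<open>L\<close> is a cone with apex \<open>j\<close>.
\<close>
lemma linked_acyclic:
  assumes linked: "\<And>i. i \<in> \<sigma> \<Longrightarrow> r - {i} \<in> K"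
  shows "rank (red_cohom L p) = 0"
proof -
  have apex: "insert j \<tau> \<in> L" if "\<tau> \<in> L" for \<tau>
  proof -
    have \<tau>: "\<tau> \<in> K" "\<tau> \<subseteq> r" using that by (auto simp: L_def full_subcomplex_def)
    then obtain i where "i \<in> \<sigma>" "i \<notin> \<tau>" using above_sigma[of \<tau>] by blast
    moreover from this have "insert j \<tau> \<subseteq> r - {i}" using \<tau> jk by (auto simp: r_def)
    ultimately show ?thesis using face_K[OF linked] \<tau> by (auto simp: L_def full_subcomplex_def r_def)
  qed
  have "f \<in> coboundaries L p" if f: "f \<in> cocycles L p" for f
  proof -
    define g where "g = restrict (cone j f) (simplices L (p - 1))"
    have "coboundary L (p - 1) g \<tau> = f \<tau>" for \<tau>
    proof (cases "\<tau> \<in> simplices L p")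
      case True
      then have fin: "finite \<tau>" and \<tau>: "\<tau> \<in> L" using L by (auto simp: simplices_def finite_complex_def)
      have "coboundary L (p - 1) g \<tau> = (\<Sum>v\<in>\<tau>. eps v \<tau> * cone j f (\<tau> - {v}))"
        using True simplices_face[OF L, of \<tau> "p - 1"] by (simp add: coboundary_def g_def)
      also have "\<dots> = f \<tau>"
      proof (rule cone_contraction[OF fin])
        assume "j \<notin> \<tau>"
        then have "insert j \<tau> \<in> simplices L (p + 1)" using apex[OF \<tau>] True fin by (simp add: simplices_def)
        then show "(\<Sum>v\<in>insert j \<tau>. eps v (insert j \<tau>) * f (insert j \<tau> - {v})) = 0"
          using f by (simp only: cocycles_iff)
      qed
      finally show ?thesis .
    next
      case False
      then show ?thesis using f by (auto simp: coboundary_def cocycles_iff PiE_def extensional_def)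
    qed
    then have "f = coboundary L (p - 1) g" by auto
    then show ?thesis by (auto simp: coboundaries_def g_def)
  qed
  moreover have "coboundaries L p \<subseteq> cocycles L p" using coboundaries_subspace[OF L, of p] by (simp add: lin_subspace_def)
  ultimately have "coboundaries L p = cocycles L p" by blast
  then show ?thesis using cocycles_rank by simp
qed

context
  assumes unlinked: "\<And>i. i \<in> \<sigma> \<Longrightarrow> r - {i} \<notin> K"
begin

text \<open>
  The candidates for simplices of dimension \<open>p + 1\<close> are the facets of \<open>r\<close>.  Those opposite to \<open>j\<close> and \<open>k\<close>
  contain \<open>\<sigma>\<close>, and the others are excluded by assumption.
\<close>
lemma top_dimension: "cocycles L p = carrier (cochains L p)"
proof -
  have "simplices L (p + 1) = {}"
  proof (rule ccontr)
    assume "simplices L (p + 1) \<noteq> {}"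
    then obtain \<tau> where "\<tau> \<in> simplices L (p + 1)" by blast
    then have \<tau>: "\<tau> \<in> K" "\<tau> \<subseteq> r" "card \<tau> = card \<sigma> + 1"
      using p unfolding L_def simplices_full by auto
    have "card r = card \<sigma> + 2" using finite_sigma jk by (simp add: r_def)
    then have "card (r - \<tau>) = 1" using \<tau> fin_r finite_subset[of \<tau> r] by (simp add: card_Diff_subset)
    then obtain v where v: "r - \<tau> = {v}" by (auto simp: card_1_singleton_iff)
    then have "\<tau> = r - {v}" "v \<in> r" using \<tau> by auto
    then have "v \<in> \<sigma>" using above_sigma[of \<tau>] \<tau> by (auto simp: r_def)
    then show False using unlinked \<tau> \<open>\<tau> = r - {v}\<close> by simp
  qed
  then show ?thesis unfolding cocycles_iff set_eq_iff by blast
qed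

lemma ind_cocycle: "\<tau> \<in> simplices L p \<Longrightarrow> restrict (ind \<tau>) (simplices L p) \<in> cocycles L p"
  unfolding top_dimension by simp

text \<open>
  Each functional on cocycles that kills coboundaries but not all of \<open>S\<close> splits off one dimension of the
  cohomology; the conclusion is shaped so that the step can be iterated.
\<close>
lemma rank_drop:
  assumes S: "lin_subspace S (vsub (cochains L p) (cocycles L p))"
    and B: "coboundaries L p \<subseteq> S"
    and \<phi>: "linear_on (cochains L p) real_line \<phi>" "\<And>f. f \<in> coboundaries L p \<Longrightarrow> \<phi> f = 0" 
    and x: "x \<in> S" "\<phi> x \<noteq> 0"
  shows "lin_subspace {f \<in> S. \<phi> f = 0} (vsub (cochains L p) (cocycles L p))"
    "coboundaries L p \<subseteq> {f \<in> S. \<phi> f = 0}"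
    "rank (vsub (cochains L p) S) = rank (vsub (cochains L p) {f \<in> S. \<phi> f = 0}) + 1"
proof -
  have sub: "S \<subseteq> carrier (cochains L p)" using S top_dimension by (auto simp: lin_subspace_def)
  show "coboundaries L p \<subseteq> {f \<in> S. \<phi> f = 0}" using B \<phi> by auto
  have fd: "fin_dim_space (vsub (cochains L p) S)" using fin_dim_space_vsub[OF cocycles_fin_dim_space[OF L] S] by (simp only: vsub_simps)
  have lin: "linear_on (vsub (cochains L p) S) real_line \<phi>" using \<phi>(1) sub by (simp add: linear_on_def subset_iff)
  show "lin_subspace {f \<in> S. \<phi> f = 0} (vsub (cochains L p) (cocycles L p))"
    using S lin by (simp add: lin_subspace_def linear_on_def subset_iff)
  show "rank (vsub (cochains L p) S) = rank (vsub (cochains L p) {f \<in> S. \<phi> f = 0}) + 1"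
    using rank_functional[OF fd lin] x by (auto simp only: vsub_simps split: if_splits)
qed

lemma rank_ge: 
  assumes "lin_subspace S (vsub (cochains L p) (cocycles L p))" "coboundaries L p \<subseteq> S"
  shows "rank (vsub (cochains L p) (coboundaries L p)) \<le> rank (vsub (cochains L p) S)"
proof -
  have "lin_subspace (coboundaries L p) (vsub (cochains L p) S)"
    using coboundaries_subspace[OF L, of p] assms by (simp add: lin_subspace_def)
  moreover have "fin_dim_space (vsub (cochains L p) S)" using fin_dim_space_vsub[OF cocycles_fin_dim_space[OF L] assms(1)] by (simp only: vsub_simps)
  ultimately show ?thesis using rank_mono[of "vsub (cochains L p) S"] by (simp only: vsub_simps)
qed

lemma cocycles_self: "lin_subspace (cocycles L p) (vsub (cochains L p) (cocycles L p))" "coboundaries L p \<subseteq> cocycles L p"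
  using lin_subspace_refl[OF cocycles_fin_dim_space[OF L, of p]] coboundaries_subspace[OF L, of p] by (simp_all add: lin_subspace_def)

text \<open>
  Evaluation of a cochain on the part of the boundary of \<open>\<tau>\<close> that consists of the facets opposite to the
  vertices in \<open>V\<close>.
\<close>
definition boundary_sum :: "nat set \<Rightarrow> nat set \<Rightarrow> (nat set \<Rightarrow> real) \<Rightarrow> real" where
  "boundary_sum V \<tau> f = (\<Sum>v\<in>V. eps v \<tau> * f (\<tau> - {v}))"

lemma boundary_sum_linear:
  assumes "\<And>v. v \<in> V \<Longrightarrow> \<tau> - {v} \<in> simplices L p"
  shows "linear_on (cochains L p) real_line (boundary_sum V \<tau>)"
  using assms by (simp add: linear_on_def boundary_sum_def distrib_left sum.distrib sum_distrib_left mult.left_commute)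

lemma boundary_sum_coboundary:
  assumes "\<And>v. v \<in> V \<Longrightarrow> \<tau> - {v} \<in> simplices L p"
  shows "boundary_sum V \<tau> (coboundary L (p - 1) g) = (\<Sum>v\<in>V. eps v \<tau> * (\<Sum>w\<in>\<tau> - {v}. eps w (\<tau> - {v}) * g (\<tau> - {v} - {w})))"
  using assms by (simp add: boundary_sum_def coboundary_def)

lemma boundary_sum_ind:
  assumes V: "finite V" "V \<subseteq> \<tau>" "u \<in> V" "\<tau> - {u} \<in> simplices L p"
    "\<And>v. v \<in> V \<Longrightarrow> \<tau> - {v} \<in> simplices L p"
  shows "boundary_sum V \<tau> (restrict (ind (\<tau> - {u})) (simplices L p)) = eps u \<tau>"
proof -
  have "boundary_sum V \<tau> (restrict (ind (\<tau> - {u})) (simplices L p)) = (\<Sum>v\<in>V. if v = u then eps u \<tau> else 0)"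
    unfolding boundary_sum_def using V by (intro sum.cong) (auto simp: ind_def)
  then show ?thesis using V by simp
qed

lemma boundary_sum_ind_zero:
  assumes "\<And>v. v \<in> V \<Longrightarrow> \<tau> - {v} \<in> simplices L p" "\<And>v. v \<in> V \<Longrightarrow> \<tau> - {v} \<noteq> \<tau>0"
  shows "boundary_sum V \<tau> (restrict (ind \<tau>0) (simplices L p)) = 0"
  using assms by (simp add: boundary_sum_def ind_def)

lemma coned_simplex:
  assumes "q \<in> {j, k}" "v \<in> \<sigma>"
  shows "insert q \<sigma> - {v} \<in> simplices L p"
proof -
  have "q \<in> {1..m} - \<sigma>" using assms jk by auto
  then have "insert q \<sigma> - {v} \<in> K" "card (insert q \<sigma> - {v}) = card \<sigma>" 
    using coned[of v q] assms finite_sigma by auto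
  then show ?thesis using assms p by (auto simp: L_def simplices_full r_def)
qed

text \<open>
  The functional is evaluation on the suspension of \<open>\<partial>\<sigma>\<close> with apices \<open>j\<close> and \<open>k\<close>, the difference of two
  cones over \<open>\<partial>\<sigma>\<close>.  It kills coboundaries, because both cones have boundary \<open>\<partial>\<sigma>\<close>, and it is \<open>\<plusminus>1\<close> on the
  indicator of a simplex that belongs to only one of the cones.
\<close>
lemma unlinked_nontrivial: "rank (red_cohom L p) \<noteq> 0"
proof -
  define \<phi> where "\<phi> f = eps j (insert j \<sigma>) * boundary_sum \<sigma> (insert j \<sigma>) f - eps k (insert k \<sigma>) * boundary_sum \<sigma> (insert k \<sigma>) f" for f
  have lin: "linear_on (cochains L p) real_line (boundary_sum \<sigma> (insert q \<sigma>))" if "q \<in> {j, k}" for q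
    using that coned_simplex by (intro boundary_sum_linear) auto
  have \<phi>: "linear_on (cochains L p) real_line \<phi>"
    using lin[of j] lin[of k] by (simp add: linear_on_def \<phi>_def algebra_simps)
  have "eps q (insert q \<sigma>) * boundary_sum \<sigma> (insert q \<sigma>) (coboundary L (p - 1) g) = - (\<Sum>w\<in>\<sigma>. eps w \<sigma> * g (\<sigma> - {w}))"
    if q: "q \<in> {j, k}" for q g
  proof -
    let ?t = "insert q \<sigma>"
    have q': "q \<notin> \<sigma>" using q jk by auto
    have "0 = (\<Sum>v\<in>?t. eps v ?t * (\<Sum>w\<in>?t - {v}. eps w (?t - {v}) * g (?t - {v} - {w})))"
      using coboundary_square_sum[of ?t g] finite_sigma by simp
    also have "\<dots> = eps q ?t * (\<Sum>w\<in>\<sigma>. eps w \<sigma> * g (\<sigma> - {w})) + boundary_sum \<sigma> ?t (coboundary L (p - 1) g)"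
      using finite_sigma q' q by (simp add: boundary_sum_coboundary coned_simplex)
    finally have "boundary_sum \<sigma> ?t (coboundary L (p - 1) g) = - (eps q ?t * (\<Sum>w\<in>\<sigma>. eps w \<sigma> * g (\<sigma> - {w})))" by simp
    then show ?thesis by (simp add: mult.assoc[symmetric])
  qed
  then have "\<phi> f = 0" if "f \<in> coboundaries L p" for f
    using that by (auto simp: \<phi>_def coboundaries_def)
  moreover obtain i where i: "i \<in> \<sigma>" using \<sigma>(3) by fastforce
  let ?f = "insert j \<sigma> - {i}"
  have f: "?f \<in> simplices L p" using coned_simplex[of j i] i by simp
  have "boundary_sum \<sigma> (insert j \<sigma>) (restrict (ind ?f) (simplices L p)) = eps i (insert j \<sigma>)"
    using finite_sigma i coned_simplex by (intro boundary_sum_ind) auto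
  moreover have "boundary_sum \<sigma> (insert k \<sigma>) (restrict (ind ?f) (simplices L p)) = 0"
    using i jk coned_simplex by (intro boundary_sum_ind_zero) auto
  ultimately have "rank (vsub (cochains L p) (cocycles L p)) = rank (vsub (cochains L p) {f \<in> cocycles L p. \<phi> f = 0}) + 1"
    and "rank (vsub (cochains L p) (coboundaries L p)) \<le> rank (vsub (cochains L p) {f \<in> cocycles L p. \<phi> f = 0})"
    using rank_drop[OF cocycles_self \<phi> _ ind_cocycle[OF f]] rank_ge by (auto simp: \<phi>_def)
  then show ?thesis using cocycles_rank by simp
qed

text \<open>
  For \<open>a\<close> and \<open>b\<close> in \<open>\<sigma>\<close> the boundaries of \<open>r - {a}\<close> and \<open>r - {b}\<close> lie in the complex.  Evaluation on them
  gives two functionals that kill coboundaries, and they are independent because the facet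
  \<open>r - {b} - {j}\<close> of the second one does not occur in the first.
\<close>
lemma unlinked_rank_two:
  assumes full: "\<And>i l. i \<in> \<sigma> \<Longrightarrow> l \<in> \<sigma> \<Longrightarrow> i \<noteq> l \<Longrightarrow> r - {i, l} \<in> K"
  shows "2 \<le> rank (red_cohom L p)"
proof -
  obtain a b where ab: "a \<in> \<sigma>" "b \<in> \<sigma>" "a \<noteq> b"
    using \<sigma>(3) card_le_Suc0_iff_eq[OF finite_sigma] by fastforce
  have face: "r - {i} - {v} \<in> simplices L p" if i: "i \<in> \<sigma>" "v \<in> r - {i}" for i v
  proof -
    have "card r = card \<sigma> + 2" using finite_sigma jk by (simp add: r_def)
    then have "card (r - {i} - {v}) = card \<sigma>" using fin_r i by (simp add: r_def)
    moreover have "r - {i} - {v} \<in> K"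
    proof -
      consider "v \<in> \<sigma>" | "v = j" | "v = k" using i by (auto simp: r_def)
      then show ?thesis
      proof cases
        case 1
        then have "r - {i, v} \<in> K" using full i by auto
        moreover have "r - {i, v} = r - {i} - {v}" by auto
        ultimately show ?thesis by simp
      next
        case 2
        then have "r - {i} - {v} = insert k \<sigma> - {i}" using i jk by (auto simp: r_def)
        then show ?thesis using coned[OF i(1) jk(2)] by simp
      next
        case 3
        then have "r - {i} - {v} = insert j \<sigma> - {i}" using i jk by (auto simp: r_def)
        then show ?thesis using coned[OF i(1) jk(1)] by simp
      qed
    qed
    ultimately show ?thesis using p by (auto simp: L_def simplices_full)
  qed
  define \<phi> where "\<phi> i = boundary_sum (r - {i}) (r - {i})" for i
  have lin: "linear_on (cochains L p) real_line (\<phi> i)" if "i \<in> \<sigma>" for i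
    unfolding \<phi>_def using face[OF that] by (intro boundary_sum_linear) auto
  have zero: "\<phi> i f = 0" if "i \<in> \<sigma>" "f \<in> coboundaries L p" for i f
  proof -
    from that(2) obtain g where "f = coboundary L (p - 1) g" by (auto simp: coboundaries_def)
    then show ?thesis
      using boundary_sum_coboundary[of "r - {i}" "r - {i}" g] face[OF that(1)] coboundary_square_sum[of "r - {i}" g] fin_r
      by (simp add: \<phi>_def)
  qed
  define x where "x i = restrict (ind (r - {i} - {j})) (simplices L p)" for i
  have jr: "j \<in> r - {i}" if "i \<in> \<sigma>" for i using that jk by (auto simp: r_def)
  have x: "x i \<in> cocycles L p" "\<phi> i (x i) \<noteq> 0" if "i \<in> \<sigma>" for i
  proof -
    show "x i \<in> cocycles L p" unfolding x_def by (rule ind_cocycle[OF face[OF that jr[OF that]]])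
    have "\<phi> i (x i) = eps j (r - {i})"
      unfolding \<phi>_def x_def using face[OF that] fin_r jr[OF that] by (intro boundary_sum_ind) auto
    then show "\<phi> i (x i) \<noteq> 0" by simp
  qed
  have "\<phi> a (x b) = 0"
    unfolding \<phi>_def x_def
  proof (rule boundary_sum_ind_zero)
    fix v assume v: "v \<in> r - {a}"
    show "r - {a} - {v} \<in> simplices L p" by (rule face[OF ab(1) v])
    have "a \<in> r - {b} - {j}" using ab jk by (auto simp: r_def)
    then show "r - {a} - {v} \<noteq> r - {b} - {j}" by blast
  qed
  note 1 = rank_drop[OF cocycles_self lin[OF ab(1)] zero[OF ab(1)] x[OF ab(1)]]
  have "x b \<in> {f \<in> cocycles L p. \<phi> a f = 0}" using x(1)[OF ab(2)] \<open>\<phi> a (x b) = 0\<close> by simp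
  note 2 = rank_drop[OF 1(1,2) lin[OF ab(2)] zero[OF ab(2)] this x(2)[OF ab(2)]]
  show ?thesis using cocycles_rank 1(3) 2(3) rank_ge[OF 2(1,2)] by linarith
qed

end

end

end

theorem theorem1:
  fixes n m :: nat and K :: "nat set set"
  assumes "m \<ge> n + 2" and "n + 2 \<ge> 3"
    and "simplicial_complex m K"
    and "{1..n + 1} \<notin> K"
    and "\<forall>j. n + 2 \<le> j \<and> j \<le> m \<longrightarrow>
           (\<forall>i\<in>{1..n + 1}. ({1..n + 1} \<union> {j}) - {i} \<in> K)"
    and "\<forall>j k. n + 2 \<le> j \<and> j < k \<and> k \<le> m \<longrightarrow>
           rank (red_cohom (full_subcomplex K ({1..n + 1} \<union> {j, k})) (int n)) \<le> 1"
    and "\<forall>j k. n + 2 \<le> j \<and> j < k \<and> k \<le> m \<longrightarrow>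
           (\<forall>i\<in>{1..n + 1}. ({1..n + 1} \<union> {j, k}) - {i} \<in> K) \<or>
           (\<forall>i\<in>{1..n + 1}. ({1..n + 1} \<union> {j, k}) - {i} \<notin> K)"
  shows "((\<exists>j k. n + 2 \<le> j \<and> j < k \<and> k \<le> m \<and>
             rank (red_cohom (full_subcomplex K ({1..n + 1} \<union> {j, k})) (int n)) = 1) \<longrightarrow>
           int (rank (HH m (K \<union> {{1..n + 1}}))) = int (rank (HH m K)) - 2) \<and>
         (\<not> (\<exists>j k. n + 2 \<le> j \<and> j < k \<and> k \<le> m \<and>
             rank (red_cohom (full_subcomplex K ({1..n + 1} \<union> {j, k})) (int n)) = 1) \<longrightarrow>
           rank (HH m (K \<union> {{1..n + 1}})) = rank (HH m K))"
proof -
  let ?s = "{1..n + 1}"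
  let ?rk = "\<lambda>j k. rank (red_cohom (full_subcomplex K (?s \<union> {j, k})) (int n))"
  let ?ok = "\<lambda>j k. n + 2 \<le> j \<and> j < k \<and> k \<le> m"
  interpret simplex_attachment m K ?s
  proof
    show "?s \<subset> {1..m}"
    proof
      show "?s \<subseteq> {1..m}" using assms(1) by auto
      have "m \<in> {1..m}" "m \<notin> ?s" using assms(1) by auto
      then show "?s \<noteq> {1..m}" by blast
    qed
  next
    fix i j assume "i \<in> ?s" "j \<in> {1..m} - ?s"
    then show "insert j ?s - {i} \<in> K" using assms(5)[rule_format, of j i] by auto
  qed (use assms(2-4) in auto)
  have p: "int n + 1 = int (card ?s)" by simp
  have outside: "j \<in> {1..m} - ?s" "k \<in> {1..m} - ?s" "j \<noteq> k" if "?ok j k" for j k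
    using that by auto
  have union: "K \<union> {?s} = insert ?s K" by simp
  show ?thesis
  proof (intro conjI impI)
    assume "\<exists>j k. n + 2 \<le> j \<and> j < k \<and> k \<le> m \<and> ?rk j k = 1"
    then obtain j k where jk: "?ok j k" and one: "?rk j k = 1" by blast
    note out = outside[OF jk]
    \<comment> \<open>Rank 1 excludes the first alternative of the dichotomy, by \<open>linked_acyclic\<close>.\<close>
    have "\<not> (\<forall>i\<in>?s. ?s \<union> {j, k} - {i} \<in> K)"
    proof
      assume "\<forall>i\<in>?s. ?s \<union> {j, k} - {i} \<in> K"
      then have "?rk j k = 0" using linked_acyclic[OF out p] by blast
      then show False using one by simp
    qed
    then have un: "\<And>i. i \<in> ?s \<Longrightarrow> ?s \<union> {j, k} - {i} \<notin> K" using assms(7) jk by blast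
    obtain i l where "i \<in> ?s" "l \<in> ?s" "i \<noteq> l" "?s \<union> {j, k} - {i, l} \<notin> K"
      using unlinked_rank_two[OF out p un] one by fastforce
    from theta_nonzero[OF out un this] have "rank (HH m (insert ?s K)) + 2 = rank (HH m K)"
      using rank_HH_attachment by simp
    then show "int (rank (HH m (K \<union> {?s}))) = int (rank (HH m K)) - 2" unfolding union by linarith
  next
    assume none: "\<not> (\<exists>j k. n + 2 \<le> j \<and> j < k \<and> k \<le> m \<and> ?rk j k = 1)"
    have linked: "?s \<union> {j, k} - {i} \<in> K" if "i \<in> ?s" "?ok j k" for i j k
    proof (rule ccontr)
      assume "?s \<union> {j, k} - {i} \<notin> K"
      then have un: "\<And>i. i \<in> ?s \<Longrightarrow> ?s \<union> {j, k} - {i} \<notin> K" using assms(7) that by blast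
      have "?rk j k \<noteq> 0" using unlinked_nontrivial[OF outside[OF that(2)] p un] by blast
      moreover have "?rk j k \<le> 1" using assms(6) that(2) by blast
      moreover have "?rk j k \<noteq> 1" using none that(2) by blast
      ultimately show False by linarith
    qed
    have "\<theta> x = 0" if "x \<in> mixed_boundaries m (insert ?s K)" "x \<in> supported top_cells" for x
    proof (rule theta_zero[OF _ that])
      fix i j k assume i: "i \<in> ?s" and j: "j \<in> {1..m} - ?s" and k: "k \<in> {1..m} - ?s" and "j \<noteq> k"
      then consider "?ok j k" | "?ok k j" by fastforce
      then show "?s \<union> {j, k} - {i} \<in> K" using linked[OF i, of j k] linked[OF i, of k j]
        by cases (simp_all only: insert_commute[of j k])
    qed
    then have "rank (HH m (insert ?s K)) = rank (HH m K)" using rank_HH_attachment by auto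
    then show "rank (HH m (K \<union> {?s})) = rank (HH m K)" unfolding union .
  qed
qed

end
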